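(* Let $(\varphi,\mu)$ and $(\tilde\varphi,\tilde\mu)$ be two solution pairs of the steady Whitham equation, i.e. $-\mu\varphi+L\varphi+\varphi^2=0$ and $-\tilde\mu\tilde\varphi+L\tilde\varphi+\tilde\varphi^2=0$ on $\mathbb{R}$, with $\mu,\tilde\mu\in(1,2)$ and $\varphi,\tilde\varphi$ positive solutions with images in $(0,\frac{\mu}{2}]$. By symmetry, assume $\mu\ge\tilde\mu$. (i) If $\tilde\varphi(x)\ge\varphi(x)$ for all $x\in\mathbb{R}$ with equality at some point, then $\tilde\varphi\equiv\varphi$ are identical. (ii) If $\tilde\varphi-\varphi$ is sign-shifting, its minimum is obtained where $\mu-\tilde\varphi-\varphi<1$.
   Context: Let $m(\xi)=\sqrt{\tanh(\xi)/\xi}$ (with $m(0)=1$) and let $K(x)=\frac{1}{2\pi}\int_{\mathbb{R}}m(\xi)e^{ix\xi}\,d\xi$ be the Whitham kernel; $K$ is even, positive, and integrable with $\|K\|_{L^1(\mathbb{R})}=1$. The operator $L$ is convolution with $K$, $Lf=K\ast f$, i.e. $Lf(x)=\int_{\mathbb{R}}K(x-y)f(y)\,dy$. A solution pair $(\varphi,\mu)$ of the steady Whitham equation consists of a function $\varphi:\mathbb{R}\to\mathbb{R}$ and a wave speed $\mu$ such that $-\mu\varphi+L\varphi+\varphi^2=0$ holds pointwise in $\mathbb{R}$. Sign-shifting means taking both positive and negative values. *)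

theory Defs
  imports "HOL-Analysis.Analysis"
begin

definition whitham_symbol :: "real \<Rightarrow> real" where
  "whitham_symbol \<xi> = (if \<xi> = 0 then 1 else sqrt (tanh \<xi> / \<xi>))"

text \<open>
  The symbol decays only like \<open>\<bar>\<xi>\<bar> powr (-1/2)\<close>, so the inversion integral is not absolutely
  convergent.  The Henstock--Kurzweil integral over the whole line is used because it includes
  convergent improper integrals; it exists for every \<open>x \<noteq> 0\<close>.  At \<open>x = 0\<close>, where the kernel is
  singular, the integral does not exist and the library value is \<open>0\<close>; this single point
  does not affect the convolution below.  The integral is real because the symbol is even, so
  \<open>Re\<close> only adjusts the type.
\<close>

definition whitham_kernel :: "real \<Rightarrow> real" where
  "whitham_kernel x =
     Re (1 / (2 * of_real pi) *
         integral UNIV (\<lambda>\<xi>::real. of_real (whitham_symbol \<xi>) * exp (\<i> * of_real x * of_real \<xi>)))"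

definition whitham_op :: "(real \<Rightarrow> real) \<Rightarrow> real \<Rightarrow> real" where
  "whitham_op f x = (LINT y|lebesgue. whitham_kernel (x - y) * f y)"

text \<open>
  Integrability states that the convolution is defined at every point; otherwise the
  Bochner integral would silently take the value \<open>0\<close>.
\<close>

definition steady_whitham_solution :: "(real \<Rightarrow> real) \<Rightarrow> real \<Rightarrow> bool" where
  "steady_whitham_solution \<phi> \<mu> \<longleftrightarrow>
     (\<forall>x. integrable lebesgue (\<lambda>y. whitham_kernel (x - y) * \<phi> y)) \<and>
     (\<forall>x. - \<mu> * \<phi> x + whitham_op \<phi> x + (\<phi> x)\<^sup>2 = 0)"

definition sign_shifting :: "(real \<Rightarrow> real) \<Rightarrow> bool" where
  "sign_shifting w \<longleftrightarrow> (\<exists>x. w x > 0) \<and> (\<exists>x. w x < 0)"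

end

theory Submission
  imports Defs
begin

text \<open>
  Put \<open>w = \<phi>' - \<phi>\<close>. Subtracting the two equations gives
  \<open>L w = (\<mu> - \<phi>' - \<phi>) w - (\<mu> - \<mu>') \<phi>'\<close>, where \<open>\<phi>' > 0\<close>, \<open>\<mu> \<ge> \<mu>'\<close> and \<open>\<mu> - \<phi>' - \<phi> \<ge> 0\<close>. The theorem is a
  strong maximum principle for the convolution \<open>L\<close>. If \<open>w \<ge> 0\<close> vanishes at a point, then
  \<open>L w \<le> 0\<close> there, and a positive kernel forces \<open>w = 0\<close> almost everywhere. If \<open>w\<close> has a negative
  minimum at \<open>x\<^sub>0\<close> with \<open>\<mu> - \<phi>' - \<phi> \<ge> 1\<close> there, then \<open>L w \<le> w x\<^sub>0\<close> at that point, and a positive kernel of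
  mass at most 1 forces \<open>w\<close> to be constant almost everywhere. In both cases \<open>L w\<close> is then constant on
  the whole line, and the equation turns this into a statement at every single point: \<open>w = 0\<close>
  everywhere in the first case, \<open>w < 0\<close> everywhere in the second, so that \<open>w\<close> does not change sign.

  The substance is that the kernel, defined by a conditionally convergent inversion integral, is
  positive away from 0 and integrable with integral at most 1
  (\<open>whitham_kernel_pos\<close>, \<open>whitham_kernel_integrable\<close>, \<open>whitham_kernel_integral_le_1\<close>).

  Positivity comes from the Euler product of \<open>tanh \<xi> / \<xi>\<close>. Its zeros and poles interlace, so the symbol
  is a product of factors \<open>sqrt ((1 + \<xi>\<^sup>2 / b\<^sup>2) / (1 + \<xi>\<^sup>2 / a\<^sup>2))\<close> with \<open>a < b\<close>. Each factor is a power series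
  with nonnegative coefficients in \<open>b\<^sup>2 / (b\<^sup>2 + \<xi>\<^sup>2)\<close>, the transform of the density \<open>b / 2 exp (- b \<bar>u\<bar>)\<close>.
  Multiplying by such transforms keeps cosine transforms nonnegative, and hence so does multiplying
  by the symbol (\<open>pos_multiplier_whitham_symbol\<close>).

  To get from multipliers to the kernel itself, the symbol is truncated by Fejer weights, which have
  nonnegative transforms. The transforms of the truncated symbol are nonnegative and converge
  pointwise to \<open>2 \<pi>\<close> times the kernel away from 0, because the symbol is decreasing and the
  second mean value theorem controls all tails at once (\<open>whitham_kernel_tendsto\<close>). Strict positivity
  follows by keeping one term of one factor (\<open>whitham_symbol_split\<close>), and the bound on the mass by
  Fatou's lemma.
\<close>

section \<open>Cosine transforms\<close>

lemma even_lborel_integral: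
  fixes f :: "real \<Rightarrow> real"
  assumes int: "integrable lborel f" and even: "\<And>x. f (- x) = f x"
  shows "(LINT x|lborel. f x) = 2 * (LINT x|lborel. indicator {0..} x * f x)"
proof -
  let ?p = "\<lambda>x. indicator {0..} x * f x" and ?n = "\<lambda>x. indicator {..0} x * f x"
  have ip: "integrable lborel ?p" and "integrable lborel ?n"
    using integrable_mult_indicator[of "{0..}" lborel f] integrable_mult_indicator[of "{..0}" lborel f] int
    by auto
  have "(LINT x|lborel. f x) = (LINT x|lborel. ?p x + ?n x)"
  proof (rule integral_cong_AE)
    show "f \<in> borel_measurable lborel" "(\<lambda>x. ?p x + ?n x) \<in> borel_measurable lborel"
      using int ip \<open>integrable lborel ?n\<close> by auto
    show "AE x in lborel. f x = ?p x + ?n x"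
      using AE_lborel_singleton[of "0::real"] by eventually_elim (auto simp: indicator_def)
  qed
  also have "\<dots> = (LINT x|lborel. ?p x) + (LINT x|lborel. ?n x)"
    using ip \<open>integrable lborel ?n\<close> by (rule Bochner_Integration.integral_add)
  also have "(LINT x|lborel. ?n x) = (LINT x|lborel. ?n (0 + (-1) * x))"
    using lborel_integral_real_affine[of "-1" ?n 0] by simp
  also have "\<dots> = (LINT x|lborel. ?p x)"
    by (rule Bochner_Integration.integral_cong) (auto simp: indicator_def even)
  finally show ?thesis by simp
qed

definition cos_transform :: "(real \<Rightarrow> real) \<Rightarrow> real \<Rightarrow> real" where
  "cos_transform h y = (LINT \<xi>|lborel. h \<xi> * cos (y * \<xi>))"

lemma integrable_mult_bounded:
  fixes f g :: "'a \<Rightarrow> real"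
  assumes "integrable M f" "g \<in> borel_measurable M" "\<And>x. \<bar>g x\<bar> \<le> C"
  shows "integrable M (\<lambda>x. g x * f x)" "integrable M (\<lambda>x. f x * g x)"
proof -
  have [measurable]: "f \<in> borel_measurable M" "g \<in> borel_measurable M" using assms by auto
  have "integrable M (\<lambda>x. C * f x)" using assms by auto
  then show "integrable M (\<lambda>x. g x * f x)"
  proof (rule Bochner_Integration.integrable_bound)
    show "AE x in M. norm (g x * f x) \<le> norm (C * f x)"
      using assms(3) by (intro AE_I2) (auto simp: abs_mult intro!: mult_right_mono order.trans[OF assms(3)])
  qed auto
  then show "integrable M (\<lambda>x. f x * g x)" by (simp add: mult.commute)
qed

lemma integrable_mult_cos:
  fixes h :: "real \<Rightarrow> real"
  shows "integrable lborel h \<Longrightarrow> integrable lborel (\<lambda>\<xi>. h \<xi> * cos (y * \<xi>))"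
  by (rule integrable_mult_bounded(2)[where f = h and C = 1]) auto

lemma cos_transform_measurable [measurable]:
  assumes [measurable]: "h \<in> borel_measurable borel"
  shows "cos_transform h \<in> borel_measurable borel"
  unfolding cos_transform_def by measurable

lemma abs_cos_transform_le:
  assumes "integrable lborel h"
  shows "\<bar>cos_transform h y\<bar> \<le> (LINT \<xi>|lborel. \<bar>h \<xi>\<bar>)"
proof -
  have "\<bar>cos_transform h y\<bar> \<le> (LINT \<xi>|lborel. \<bar>h \<xi> * cos (y * \<xi>)\<bar>)"
    unfolding cos_transform_def by (rule integral_abs_bound)
  also have "\<dots> \<le> (LINT \<xi>|lborel. \<bar>h \<xi>\<bar>)"
    by (intro integral_mono Bochner_Integration.integrable_abs integrable_mult_cos assms)
      (simp add: abs_mult mult_left_le)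
  finally show ?thesis .
qed

text \<open>
  The convolution theorem in cosine form. By Fubini and
  \<open>2 cos (\<xi> u) cos (y \<xi>) = cos ((u + y) \<xi>) + cos ((u - y) \<xi>)\<close>, multiplying \<open>h\<close> by the transform
  of \<open>g\<close> averages translates of the transform of \<open>h\<close> against \<open>g\<close>; if both are nonnegative, so is
  the transform of the product. Taking \<open>y = 0\<close> gives Parseval's identity.
\<close>

lemma cos_transform_mult_cos_transform:
  assumes h: "integrable lborel h" and g: "integrable lborel g"
  shows "cos_transform (\<lambda>\<xi>. cos_transform g \<xi> * h \<xi>) y =
    (LINT u|lborel. g u * ((cos_transform h (u + y) + cos_transform h (u - y)) / 2))"
proof -
  have [measurable]: "h \<in> borel_measurable borel" "g \<in> borel_measurable borel"
    using h g by (auto dest: borel_measurable_integrable)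
  have 1: "integrable (lborel \<Otimes>\<^sub>M lborel) (\<lambda>(u, \<xi>). g u * h \<xi>)"
    using g h by (intro lborel_pair.Fubini_integrable) (auto simp: abs_mult)
  \<comment> \<open>The trigonometric factors are bounded by 1, so the tensor product dominates.\<close>
  have 2: "integrable (lborel \<Otimes>\<^sub>M lborel) (\<lambda>(u, \<xi>). g u * h \<xi> * (cos (\<xi> * u) * cos (y * \<xi>)))"
  proof (rule Bochner_Integration.integrable_bound[OF 1])
    have "\<bar>cos (b * a) * cos (y * b)\<bar> \<le> 1" for a b
      using mult_le_one[of "\<bar>cos (b * a)\<bar>" "\<bar>cos (y * b)\<bar>"] by (simp add: abs_mult)
    then show "AE x in lborel \<Otimes>\<^sub>M lborel. norm (case x of (u, \<xi>) \<Rightarrow> g u * h \<xi> * (cos (\<xi> * u) * cos (y * \<xi>)))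
        \<le> norm (case x of (u, \<xi>) \<Rightarrow> g u * h \<xi>)"
      by (intro AE_I2) (auto simp: abs_mult[of "_ * _" "cos _ * cos _"] mult_left_le)
  qed measurable
  have "cos_transform (\<lambda>\<xi>. cos_transform g \<xi> * h \<xi>) y =
      (LINT \<xi>|lborel. LINT u|lborel. g u * h \<xi> * (cos (\<xi> * u) * cos (y * \<xi>)))"
    unfolding cos_transform_def
  proof (intro Bochner_Integration.integral_cong refl)
    fix \<xi>
    have "(LINT u|lborel. g u * h \<xi> * (cos (\<xi> * u) * cos (y * \<xi>))) =
        (LINT u|lborel. (g u * cos (\<xi> * u)) * (h \<xi> * cos (y * \<xi>)))"
      by (simp add: mult_ac)
    then show "(LINT u|lborel. g u * cos (\<xi> * u)) * h \<xi> * cos (y * \<xi>) =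
        (LINT u|lborel. g u * h \<xi> * (cos (\<xi> * u) * cos (y * \<xi>)))"
      by simp
  qed
  also have "\<dots> = (LINT u|lborel. LINT \<xi>|lborel. g u * h \<xi> * (cos (\<xi> * u) * cos (y * \<xi>)))"
    by (rule lborel_pair.Fubini_integral[OF 2])
  also have "\<dots> = (LINT u|lborel. g u * ((cos_transform h (u + y) + cos_transform h (u - y)) / 2))"
  proof (intro Bochner_Integration.integral_cong refl)
    fix u
    have "(LINT \<xi>|lborel. g u * h \<xi> * (cos (\<xi> * u) * cos (y * \<xi>))) =
        (LINT \<xi>|lborel. g u / 2 * (h \<xi> * cos ((u + y) * \<xi>) + h \<xi> * cos ((u - y) * \<xi>)))"
      by (intro Bochner_Integration.integral_cong refl)
        (simp add: cos_times_cos algebra_simps add_divide_distrib)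
    also have "\<dots> = g u / 2 * (cos_transform h (u + y) + cos_transform h (u - y))"
      unfolding cos_transform_def
      by (simp add: Bochner_Integration.integral_add integrable_mult_cos[OF h])
    finally show "(LINT \<xi>|lborel. g u * h \<xi> * (cos (\<xi> * u) * cos (y * \<xi>))) =
        g u * ((cos_transform h (u + y) + cos_transform h (u - y)) / 2)"
      by simp
  qed
  finally show ?thesis .
qed

text \<open>
  The exponential \<open>exp (- b \<bar>u\<bar>)\<close> is used twice: as the source of the Laplace multipliers from which
  the Whitham symbol is built, and as the damping factor that makes the total mass of the kernel
  computable.
\<close>

lemma
  fixes b :: real
  assumes b: "b > 0"
  shows integrable_exp_abs: "integrable lborel (\<lambda>u::real. exp (- b * \<bar>u\<bar>))"
    and cos_transform_exp_abs: "cos_transform (\<lambda>u. exp (- b * \<bar>u\<bar>)) \<xi> = 2 * b / (b\<^sup>2 + \<xi>\<^sup>2)"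
proof -
  have lim0: "((\<lambda>u. - exp (- b * u) / b) \<longlongrightarrow> - 0 / b) at_top"
    by (intro tendsto_intros filterlim_compose[OF exp_at_bot]
        filterlim_tendsto_neg_mult_at_bot[OF tendsto_const] filterlim_ident) (use b in auto)
  have "(\<integral>\<^sup>+u. ennreal (exp (- b * u)) * indicator {0..} u \<partial>lborel) = 0 - (- exp (- b * 0) / b)"
    by (intro nn_integral_FTC_atLeast) (use lim0 b in \<open>auto intro!: derivative_eq_intros\<close>)
  then have ip: "integrable lborel (\<lambda>u. exp (- b * u) * indicator {0..} u)"
    by (intro integrableI_nonneg) (auto simp: ennreal_mult simp flip: ennreal_indicator)
  from ip have "integrable lborel (\<lambda>u. exp (- b * (0 + -1 * u)) * indicator {0..} (0 + -1 * u))"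
    by (rule lborel_integrable_real_affine) auto
  from Bochner_Integration.integrable_add[OF ip this]
  show int: "integrable lborel (\<lambda>u::real. exp (- b * \<bar>u\<bar>))"
    by (rule Bochner_Integration.integrable_bound) (auto simp: indicator_def)
  let ?f = "\<lambda>u. exp (- b * u) * cos (\<xi> * u)"
  \<comment> \<open>An antiderivative of the damped cosine, found by integrating by parts twice.\<close>
  define F where "F u = exp (- b * u) * (\<xi> * sin (\<xi> * u) - b * cos (\<xi> * u)) / (b\<^sup>2 + \<xi>\<^sup>2)" for u
  have pos: "b\<^sup>2 + \<xi>\<^sup>2 > 0" using b by (simp add: sum_power2_gt_zero_iff)
  have "((\<lambda>u. exp (- b * u) * (\<xi> * sin (\<xi> * u) - b * cos (\<xi> * u))) has_real_derivative
      ?f u * (b\<^sup>2 + \<xi>\<^sup>2)) (at u)" for u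
    by (auto intro!: derivative_eq_intros simp: algebra_simps power2_eq_square)
  from DERIV_cdivide[OF this, of "b\<^sup>2 + \<xi>\<^sup>2"]
  have "(F has_real_derivative ?f u) (at u)" for u
    unfolding F_def nonzero_mult_div_cancel_right[OF less_imp_neq[OF pos, symmetric]] .
  then have fin: "(LINT u|lborel. indicator {0..real n} u *\<^sub>R ?f u) = F n - F 0" for n :: nat
    by (intro integral_FTC_Icc)
      (auto intro!: continuous_intros simp: has_real_derivative_iff_has_vector_derivative
        intro: has_vector_derivative_at_within)
  have "(\<lambda>n. LINT u|lborel. indicator {0..real n} u *\<^sub>R ?f u) \<longlonglongrightarrow>
      (LINT u|lborel. indicator {0..} u * ?f u)"
  proof (rule integral_dominated_convergence[OF _ _ ip])
    show "AE u in lborel. (\<lambda>n. indicator {0..real n} u *\<^sub>R ?f u) \<longlonglongrightarrow> indicator {0..} u * ?f u"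
    proof (rule AE_I2)
      fix u
      have "\<forall>\<^sub>F n in sequentially. indicator {0..real n} u *\<^sub>R ?f u = indicator {0..} u * ?f u"
        using eventually_ge_at_top[of "nat \<lceil>u\<rceil>"] by eventually_elim (auto simp: indicator_def; linarith)
      then show "(\<lambda>n. indicator {0..real n} u *\<^sub>R ?f u) \<longlonglongrightarrow> indicator {0..} u * ?f u"
        by (rule tendsto_eventually)
    qed
  qed (auto simp: indicator_def abs_mult)
  moreover have "(\<lambda>n. F (real n) - F 0) \<longlonglongrightarrow> 0 - F 0"
  proof (intro tendsto_intros)
    have B: "\<bar>\<xi> * sin (\<xi> * u) - b * cos (\<xi> * u)\<bar> \<le> \<bar>\<xi>\<bar> + b" for u
    proof -
      have "\<bar>\<xi>\<bar> * \<bar>sin (\<xi> * u)\<bar> \<le> \<bar>\<xi>\<bar>" "b * \<bar>cos (\<xi> * u)\<bar> \<le> b"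
        using b by (auto intro: mult_left_le)
      then show ?thesis
        using abs_triangle_ineq4[of "\<xi> * sin (\<xi> * u)" "b * cos (\<xi> * u)"] b
        unfolding abs_mult by linarith
    qed
    show "(\<lambda>n. F (real n)) \<longlonglongrightarrow> 0"
    proof (rule Lim_null_comparison)
      show "\<forall>\<^sub>F n in sequentially. norm (F (real n)) \<le> exp (- b * real n) * (\<bar>\<xi>\<bar> + b) / (b\<^sup>2 + \<xi>\<^sup>2)"
        unfolding F_def using B pos
        by (intro always_eventually allI)
          (auto simp: abs_mult abs_of_pos intro!: divide_right_mono mult_left_mono)
      have "(\<lambda>n. exp (- b * real n)) \<longlonglongrightarrow> 0"
        by (intro filterlim_compose[OF exp_at_bot]
            filterlim_tendsto_neg_mult_at_bot[OF tendsto_const] filterlim_real_sequentially)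
          (use b in auto)
      then show "(\<lambda>n. exp (- b * real n) * (\<bar>\<xi>\<bar> + b) / (b\<^sup>2 + \<xi>\<^sup>2)) \<longlonglongrightarrow> 0"
        by (auto intro!: tendsto_divide_zero tendsto_mult_left_zero)
    qed
  qed
  ultimately have half: "(LINT u|lborel. indicator {0..} u * ?f u) = b / (b\<^sup>2 + \<xi>\<^sup>2)"
    unfolding fin using LIMSEQ_unique by (fastforce simp: F_def)
  have "cos_transform (\<lambda>u. exp (- b * \<bar>u\<bar>)) \<xi> =
      2 * (LINT u|lborel. indicator {0..} u * (exp (- b * \<bar>u\<bar>) * cos (\<xi> * u)))"
    unfolding cos_transform_def
    by (rule even_lborel_integral[OF integrable_mult_cos[OF int]]) auto
  also have "(LINT u|lborel. indicator {0..} u * (exp (- b * \<bar>u\<bar>) * cos (\<xi> * u))) =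
      (LINT u|lborel. indicator {0..} u * ?f u)"
    by (rule Bochner_Integration.integral_cong) (auto simp: indicator_def)
  finally show "cos_transform (\<lambda>u. exp (- b * \<bar>u\<bar>)) \<xi> = 2 * b / (b\<^sup>2 + \<xi>\<^sup>2)"
    unfolding half by simp
qed

section \<open>Positive multipliers\<close>

definition pos_def_weight :: "(real \<Rightarrow> real) \<Rightarrow> bool" where
  "pos_def_weight h \<longleftrightarrow> integrable lborel h \<and> (\<forall>y. 0 \<le> cos_transform h y)"

text \<open>
  Multiplication by \<open>r\<close> preserves nonnegativity of cosine transforms. This replaces the statement
  that \<open>r\<close> is the Fourier transform of a positive measure: that measure never has to be constructed,
  and closure under products, sums and bounded pointwise limits is immediate. The symbol itself
  cannot be treated as a weight, since it is not integrable.
\<close>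

definition pos_multiplier :: "(real \<Rightarrow> real) \<Rightarrow> bool" where
  "pos_multiplier r \<longleftrightarrow> r \<in> borel_measurable borel \<and> (\<exists>C. \<forall>\<xi>. \<bar>r \<xi>\<bar> \<le> C) \<and>
     (\<forall>h. pos_def_weight h \<longrightarrow> (\<forall>y. 0 \<le> cos_transform (\<lambda>\<xi>. r \<xi> * h \<xi>) y))"

lemma pos_multiplier_measurable: "pos_multiplier r \<Longrightarrow> r \<in> borel_measurable borel"
  by (simp add: pos_multiplier_def)

lemma pos_multiplier_integrable:
  assumes "pos_multiplier r" "integrable lborel h"
  shows "integrable lborel (\<lambda>\<xi>. r \<xi> * h \<xi>)"
proof -
  obtain C where "\<And>\<xi>. \<bar>r \<xi>\<bar> \<le> C" using assms by (auto simp: pos_multiplier_def)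
  then show ?thesis
    using assms by (intro integrable_mult_bounded(1)[of lborel h r C]) (auto simp: pos_multiplier_def)
qed

lemma pos_multiplier_weight:
  assumes "pos_multiplier r" "pos_def_weight h"
  shows "pos_def_weight (\<lambda>\<xi>. r \<xi> * h \<xi>)"
  using assms pos_multiplier_integrable[of r h] unfolding pos_def_weight_def
  by (auto simp: pos_multiplier_def pos_def_weight_def)

lemma pos_multiplier_mult:
  assumes "pos_multiplier r" "pos_multiplier s"
  shows "pos_multiplier (\<lambda>\<xi>. r \<xi> * s \<xi>)"
  unfolding pos_multiplier_def
proof (intro conjI allI impI)
  show "(\<lambda>\<xi>. r \<xi> * s \<xi>) \<in> borel_measurable borel"
    using assms by (auto simp: pos_multiplier_def)
  obtain C D where "\<And>\<xi>. \<bar>r \<xi>\<bar> \<le> C" "\<And>\<xi>. \<bar>s \<xi>\<bar> \<le> D" using assms by (auto simp: pos_multiplier_def)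
  then have "\<bar>r \<xi> * s \<xi>\<bar> \<le> C * D" for \<xi>
    by (simp add: abs_mult) (meson abs_ge_zero mult_mono order_trans)
  then show "\<exists>C. \<forall>\<xi>. \<bar>r \<xi> * s \<xi>\<bar> \<le> C" by blast
next
  fix h y assume "pos_def_weight h"
  with assms have "pos_def_weight (\<lambda>\<xi>. r \<xi> * (s \<xi> * h \<xi>))" by (intro pos_multiplier_weight)
  then show "0 \<le> cos_transform (\<lambda>\<xi>. r \<xi> * s \<xi> * h \<xi>) y" by (simp add: pos_def_weight_def mult.assoc)
qed

lemma pos_multiplier_const: "0 \<le> c \<Longrightarrow> pos_multiplier (\<lambda>_. c)"
  unfolding pos_multiplier_def by (auto simp: pos_def_weight_def cos_transform_def mult.assoc)

lemma cos_transform_add: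
  assumes "integrable lborel f" "integrable lborel g"
  shows "cos_transform (\<lambda>\<xi>. f \<xi> + g \<xi>) y = cos_transform f y + cos_transform g y"
  using integrable_mult_cos[OF assms(1), of y] integrable_mult_cos[OF assms(2), of y]
  by (simp add: cos_transform_def distrib_right)

lemma cos_transform_cmult: "cos_transform (\<lambda>\<xi>. c * f \<xi>) y = c * cos_transform f y"
  by (simp add: cos_transform_def mult.assoc)

lemma pos_multiplier_add:
  assumes r: "pos_multiplier r" and s: "pos_multiplier s"
  shows "pos_multiplier (\<lambda>\<xi>. r \<xi> + s \<xi>)"
  unfolding pos_multiplier_def
proof (intro conjI allI impI)
  show "(\<lambda>\<xi>. r \<xi> + s \<xi>) \<in> borel_measurable borel"
    using assms by (auto simp: pos_multiplier_def)
  obtain C D where "\<And>\<xi>. \<bar>r \<xi>\<bar> \<le> C" "\<And>\<xi>. \<bar>s \<xi>\<bar> \<le> D" using assms by (auto simp: pos_multiplier_def)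
  then have "\<bar>r \<xi> + s \<xi>\<bar> \<le> C + D" for \<xi>
    by (meson abs_triangle_ineq add_mono order_trans)
  then show "\<exists>C. \<forall>\<xi>. \<bar>r \<xi> + s \<xi>\<bar> \<le> C" by blast
next
  fix h y assume h: "pos_def_weight h"
  then have "integrable lborel h" by (simp add: pos_def_weight_def)
  with pos_multiplier_weight[OF r h] pos_multiplier_weight[OF s h]
  show "0 \<le> cos_transform (\<lambda>\<xi>. (r \<xi> + s \<xi>) * h \<xi>) y"
    by (simp add: distrib_right cos_transform_add pos_def_weight_def)
qed

lemma pos_multiplier_cmult: "0 \<le> c \<Longrightarrow> pos_multiplier r \<Longrightarrow> pos_multiplier (\<lambda>\<xi>. c * r \<xi>)"
  by (intro pos_multiplier_mult pos_multiplier_const)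

lemma pos_multiplier_sum:
  "(\<And>i. i \<in> I \<Longrightarrow> pos_multiplier (r i)) \<Longrightarrow> pos_multiplier (\<lambda>\<xi>. \<Sum>i\<in>I. r i \<xi>)"
  by (induction I rule: infinite_finite_induct) (auto intro: pos_multiplier_const pos_multiplier_add)

lemma pos_multiplier_prod:
  "(\<And>i. i \<in> I \<Longrightarrow> pos_multiplier (r i)) \<Longrightarrow> pos_multiplier (\<lambda>\<xi>. \<Prod>i\<in>I. r i \<xi>)"
  by (induction I rule: infinite_finite_induct) (auto intro: pos_multiplier_const pos_multiplier_mult)

lemma pos_multiplier_power: "pos_multiplier r \<Longrightarrow> pos_multiplier (\<lambda>\<xi>. r \<xi> ^ k)"
  by (induction k) (auto intro: pos_multiplier_const pos_multiplier_mult)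

text \<open>
  Dominated convergence, with the integrable weight as dominating function, passes nonnegativity of
  the transforms to the limit.
\<close>

lemma pos_multiplier_limit:
  fixes r :: "nat \<Rightarrow> real \<Rightarrow> real"
  assumes r: "\<And>n. pos_multiplier (r n)" and bound: "\<And>n \<xi>. \<bar>r n \<xi>\<bar> \<le> C"
    and lim: "\<And>\<xi>. (\<lambda>n. r n \<xi>) \<longlonglongrightarrow> s \<xi>"
  shows "pos_multiplier s"
  unfolding pos_multiplier_def
proof (intro conjI allI impI)
  have [measurable]: "r n \<in> borel_measurable borel" for n using r by (rule pos_multiplier_measurable)
  show s_meas [measurable]: "s \<in> borel_measurable borel"
    using lim by (rule borel_measurable_LIMSEQ_real) simp
  have "\<bar>s \<xi>\<bar> \<le> C" for \<xi>
    by (rule LIMSEQ_le_const2[OF tendsto_rabs[OF lim]]) (use bound in auto)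
  then show "\<exists>C. \<forall>\<xi>. \<bar>s \<xi>\<bar> \<le> C" by blast
next
  have [measurable]: "r n \<in> borel_measurable borel" for n using r by (rule pos_multiplier_measurable)
  have s_meas [measurable]: "s \<in> borel_measurable borel"
    using lim by (rule borel_measurable_LIMSEQ_real) simp
  fix h y assume h: "pos_def_weight h"
  then have int: "integrable lborel h" by (simp add: pos_def_weight_def)
  then have [measurable]: "h \<in> borel_measurable borel" by (auto dest: borel_measurable_integrable)
  have "(\<lambda>n. cos_transform (\<lambda>\<xi>. r n \<xi> * h \<xi>) y) \<longlonglongrightarrow> cos_transform (\<lambda>\<xi>. s \<xi> * h \<xi>) y"
    unfolding cos_transform_def
  proof (rule integral_dominated_convergence[where w = "\<lambda>\<xi>. C * \<bar>h \<xi>\<bar>"])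
    show "AE \<xi> in lborel. norm (r n \<xi> * h \<xi> * cos (y * \<xi>)) \<le> C * \<bar>h \<xi>\<bar>" for n
    proof (rule AE_I2)
      fix \<xi>
      have "norm (r n \<xi> * h \<xi> * cos (y * \<xi>)) \<le> \<bar>r n \<xi>\<bar> * \<bar>h \<xi>\<bar>"
        by (simp add: abs_mult mult_left_le)
      also have "\<dots> \<le> C * \<bar>h \<xi>\<bar>" by (intro mult_right_mono bound) auto
      finally show "norm (r n \<xi> * h \<xi> * cos (y * \<xi>)) \<le> C * \<bar>h \<xi>\<bar>" .
    qed
  qed (use int lim in \<open>auto intro!: tendsto_intros AE_I2\<close>)
  then show "0 \<le> cos_transform (\<lambda>\<xi>. s \<xi> * h \<xi>) y"
    by (rule LIMSEQ_le_const)
      (use pos_multiplier_weight[OF r h] in \<open>auto simp: pos_def_weight_def\<close>)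
qed

definition laplace_symbol :: "real \<Rightarrow> real \<Rightarrow> real" where
  "laplace_symbol b \<xi> = b\<^sup>2 / (b\<^sup>2 + \<xi>\<^sup>2)"

lemma laplace_symbol_eq:
  assumes "b > 0"
  shows "laplace_symbol b \<xi> = cos_transform (\<lambda>u. b / 2 * exp (- b * \<bar>u\<bar>)) \<xi>"
  using assms unfolding cos_transform_cmult cos_transform_exp_abs[OF assms]
  by (simp add: laplace_symbol_def power2_eq_square)

lemma laplace_symbol_bounds:
  assumes "b > 0"
  shows "0 < laplace_symbol b \<xi>" "laplace_symbol b \<xi> \<le> 1"
proof -
  have "b\<^sup>2 + \<xi>\<^sup>2 > 0" using assms by (simp add: sum_power2_gt_zero_iff)
  then show "0 < laplace_symbol b \<xi>" "laplace_symbol b \<xi> \<le> 1"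
    using assms by (auto simp: laplace_symbol_def)
qed

lemma laplace_symbol_measurable [measurable]: "laplace_symbol b \<in> borel_measurable borel"
  unfolding laplace_symbol_def by measurable

lemma cos_transform_laplace_mult:
  assumes b: "b > 0" and h: "integrable lborel h"
  shows "cos_transform (\<lambda>\<xi>. laplace_symbol b \<xi> * h \<xi>) y =
    (LINT u|lborel. b / 2 * exp (- b * \<bar>u\<bar>) * ((cos_transform h (u + y) + cos_transform h (u - y)) / 2))"
  unfolding laplace_symbol_eq[OF b]
  by (rule cos_transform_mult_cos_transform[OF h]) (use integrable_exp_abs[OF b] in auto)

lemma pos_multiplier_laplace:
  assumes b: "b > 0"
  shows "pos_multiplier (laplace_symbol b)"
  unfolding pos_multiplier_def
proof (intro conjI allI impI exI)
  show "\<bar>laplace_symbol b \<xi>\<bar> \<le> 1" for \<xi>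
    using laplace_symbol_bounds[OF b, of \<xi>] by simp
  fix h y assume "pos_def_weight h"
  then show "0 \<le> cos_transform (\<lambda>\<xi>. laplace_symbol b \<xi> * h \<xi>) y"
    unfolding pos_def_weight_def using b
    by (auto simp: cos_transform_laplace_mult intro!: integral_nonneg)
qed simp

text \<open>
  A quantitative version of \<open>pos_multiplier_laplace\<close>: the exponential density is comparable with its
  own translates, \<open>exp (- b \<bar>u\<bar>) \<ge> exp (- b \<bar>y\<bar>) exp (- b \<bar>u + y\<bar>)\<close>, so that averaging against it
  spreads whatever mass there is to every point \<open>y\<close>. This is where strict positivity of the kernel
  comes from.
\<close>

lemma cos_transform_laplace_lower:
  assumes b: "b > 0" and h: "pos_def_weight h"
  shows "exp (- b * \<bar>y\<bar>) * (LINT \<xi>|lborel. laplace_symbol b \<xi> * h \<xi>) \<le>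
    cos_transform (\<lambda>\<xi>. laplace_symbol b \<xi> * h \<xi>) y"
proof -
  from h have int: "integrable lborel h" and nn: "\<And>u. 0 \<le> cos_transform h u"
    by (auto simp: pos_def_weight_def)
  then have [measurable]: "h \<in> borel_measurable borel" by (auto dest: borel_measurable_integrable)
  let ?g = "\<lambda>u. b / 2 * exp (- b * \<bar>u\<bar>)"
  let ?G = "\<lambda>u. ?g u * cos_transform h u"
  have ig: "integrable lborel ?g" using integrable_exp_abs[OF b] by simp
  have prod: "integrable lborel (\<lambda>u. ?g u * cos_transform h (u + v))" for v
    by (rule integrable_mult_bounded(2)[OF ig]) (use abs_cos_transform_le[OF int] in auto)
  have iG: "integrable lborel ?G" using prod[of 0] by simp
  have shift: "integrable lborel (\<lambda>u. ?G (u + v))" "(LINT u|lborel. ?G (u + v)) = (LINT u|lborel. ?G u)" for v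
    using lborel_integrable_real_affine[OF iG, of 1 v] lborel_integral_real_affine[of 1 ?G v]
    by (simp_all add: add.commute)
  have shift_le: "exp (- b * \<bar>y\<bar>) * ?G (u + v) \<le> ?g u * cos_transform h (u + v)" if "\<bar>v\<bar> = \<bar>y\<bar>" for u v
  proof -
    have "\<bar>u\<bar> \<le> \<bar>y\<bar> + \<bar>u + v\<bar>" using that by linarith
    then have "b * \<bar>u\<bar> \<le> b * (\<bar>y\<bar> + \<bar>u + v\<bar>)" using b by (intro mult_left_mono) auto
    then have "exp (- b * \<bar>y\<bar>) * exp (- b * \<bar>u + v\<bar>) \<le> exp (- b * \<bar>u\<bar>)"
      by (simp add: algebra_simps flip: exp_add)
    then have "(exp (- b * \<bar>y\<bar>) * exp (- b * \<bar>u + v\<bar>)) * (b / 2 * cos_transform h (u + v)) \<le>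
        exp (- b * \<bar>u\<bar>) * (b / 2 * cos_transform h (u + v))"
      using b nn by (intro mult_right_mono) auto
    then show ?thesis by (simp add: mult_ac)
  qed
  have average: "(LINT u|lborel. (c * G (u + y) + c * G (u - y)) / 2) = c * I"
    if "integrable lborel (\<lambda>u. G (u + y))" "integrable lborel (\<lambda>u. G (u - y))"
      "(LINT u|lborel. G (u + y)) = I" "(LINT u|lborel. G (u - y)) = I" for G :: "real \<Rightarrow> real" and c I
    using that by simp
  have "exp (- b * \<bar>y\<bar>) * (LINT u|lborel. ?G u) =
      (LINT u|lborel. (exp (- b * \<bar>y\<bar>) * ?G (u + y) + exp (- b * \<bar>y\<bar>) * ?G (u - y)) / 2)"
    using shift[of y] shift[of "- y"] by (intro average[of ?G, symmetric]) simp_all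
  also have "\<dots> \<le> (LINT u|lborel. (?g u * cos_transform h (u + y) + ?g u * cos_transform h (u - y)) / 2)"
  proof (rule integral_mono)
    show "integrable lborel (\<lambda>u. (exp (- b * \<bar>y\<bar>) * ?G (u + y) + exp (- b * \<bar>y\<bar>) * ?G (u - y)) / 2)"
      using shift(1)[of y] shift(1)[of "- y"]
      by (intro integrable_divide_zero Bochner_Integration.integrable_add integrable_mult_right) auto
    show "integrable lborel (\<lambda>u. (?g u * cos_transform h (u + y) + ?g u * cos_transform h (u - y)) / 2)"
      using prod[of y] prod[of "- y"] by simp
    show "(exp (- b * \<bar>y\<bar>) * ?G (u + y) + exp (- b * \<bar>y\<bar>) * ?G (u - y)) / 2 \<le>
        (?g u * cos_transform h (u + y) + ?g u * cos_transform h (u - y)) / 2" for u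
      using shift_le[of y u] shift_le[of "- y" u] by simp
  qed
  also have "\<dots> = cos_transform (\<lambda>\<xi>. laplace_symbol b \<xi> * h \<xi>) y"
    unfolding cos_transform_laplace_mult[OF b int]
    by (intro Bochner_Integration.integral_cong refl) (simp add: algebra_simps add_divide_distrib)
  also have "(LINT u|lborel. ?G u) = cos_transform (\<lambda>\<xi>. laplace_symbol b \<xi> * h \<xi>) 0"
    unfolding cos_transform_laplace_mult[OF b int] by simp
  finally show ?thesis by (simp add: cos_transform_def)
qed

section \<open>The Whitham symbol as a positive multiplier\<close>

definition whitham_factor :: "real \<Rightarrow> real \<Rightarrow> real \<Rightarrow> real" where
  "whitham_factor a b \<xi> = sqrt ((1 + \<xi>\<^sup>2 / b\<^sup>2) / (1 + \<xi>\<^sup>2 / a\<^sup>2))"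

lemma whitham_factor_pos: "0 < whitham_factor a b \<xi>"
proof -
  have "0 < 1 + \<xi>\<^sup>2 / c\<^sup>2" for c :: real by (intro add_pos_nonneg) auto
  then show ?thesis by (simp add: whitham_factor_def)
qed

text \<open>
  With \<open>p = 1 - a\<^sup>2 / b\<^sup>2\<close> one has \<open>(a\<^sup>2 + \<xi>\<^sup>2) / (b\<^sup>2 + \<xi>\<^sup>2) = 1 - p laplace_symbol b \<xi>\<close>. The factor is
  therefore an inverse square root of \<open>1 - p laplace_symbol b\<close>, and the binomial series of this power
  has positive coefficients.
\<close>

lemma whitham_factor_eq:
  assumes "0 < a" "a < b"
  shows "whitham_factor a b \<xi> = a / b * (1 - (1 - a\<^sup>2 / b\<^sup>2) * laplace_symbol b \<xi>) powr (- 1 / 2)"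
proof -
  have pos: "a\<^sup>2 + \<xi>\<^sup>2 > 0" "b\<^sup>2 + \<xi>\<^sup>2 > 0" using assms by (auto simp: sum_power2_gt_zero_iff)
  have 1: "1 - (1 - a\<^sup>2 / b\<^sup>2) * laplace_symbol b \<xi> = (a\<^sup>2 + \<xi>\<^sup>2) / (b\<^sup>2 + \<xi>\<^sup>2)"
  proof -
    have "(1 - a\<^sup>2 / b\<^sup>2) * b\<^sup>2 = b\<^sup>2 - a\<^sup>2" using assms by (simp add: left_diff_distrib)
    then have l: "(1 - a\<^sup>2 / b\<^sup>2) * laplace_symbol b \<xi> = (b\<^sup>2 - a\<^sup>2) / (b\<^sup>2 + \<xi>\<^sup>2)"
      by (simp add: laplace_symbol_def)
    show ?thesis unfolding l using pos assms by (subst diff_eq_eq) (simp flip: add_divide_distrib)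
  qed
  have 2: "(1 + \<xi>\<^sup>2 / b\<^sup>2) / (1 + \<xi>\<^sup>2 / a\<^sup>2) = (a / b)\<^sup>2 * ((b\<^sup>2 + \<xi>\<^sup>2) / (a\<^sup>2 + \<xi>\<^sup>2))"
  proof -
    have "1 + \<xi>\<^sup>2 / b\<^sup>2 = (b\<^sup>2 + \<xi>\<^sup>2) / b\<^sup>2" "1 + \<xi>\<^sup>2 / a\<^sup>2 = (a\<^sup>2 + \<xi>\<^sup>2) / a\<^sup>2"
      using assms by (simp_all add: add_divide_distrib)
    then show ?thesis by (simp add: power_divide)
  qed
  have "((a\<^sup>2 + \<xi>\<^sup>2) / (b\<^sup>2 + \<xi>\<^sup>2)) powr (- 1 / 2) = sqrt ((b\<^sup>2 + \<xi>\<^sup>2) / (a\<^sup>2 + \<xi>\<^sup>2))"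
    using pos powr_minus[of "(a\<^sup>2 + \<xi>\<^sup>2) / (b\<^sup>2 + \<xi>\<^sup>2)" "1/2"]
    by (simp add: powr_half_sqrt real_sqrt_divide)
  then show ?thesis
    unfolding whitham_factor_def 1 2 real_sqrt_mult using assms by simp
qed

lemma whitham_factor_antimono:
  assumes "0 < a" "a < b" "\<bar>\<xi>\<bar> \<le> \<bar>\<eta>\<bar>"
  shows "whitham_factor a b \<eta> \<le> whitham_factor a b \<xi>"
proof -
  have le: "\<xi>\<^sup>2 \<le> \<eta>\<^sup>2" using assms(3) by (simp add: abs_le_square_iff)
  have ab: "1 / b\<^sup>2 \<le> 1 / a\<^sup>2" using assms by (intro divide_left_mono) (auto intro: power_mono)
  have pos: "0 < 1 + x\<^sup>2 / a\<^sup>2" for x :: real by (intro add_pos_nonneg) auto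
  have "(\<eta>\<^sup>2 - \<xi>\<^sup>2) * (1 / b\<^sup>2) \<le> (\<eta>\<^sup>2 - \<xi>\<^sup>2) * (1 / a\<^sup>2)" using le ab by (intro mult_left_mono) auto
  then have "(1 + \<eta>\<^sup>2 / b\<^sup>2) * (1 + \<xi>\<^sup>2 / a\<^sup>2) \<le> (1 + \<xi>\<^sup>2 / b\<^sup>2) * (1 + \<eta>\<^sup>2 / a\<^sup>2)"
    by (simp add: algebra_simps diff_divide_distrib)
  moreover have "x / y \<le> z / w" if "x * w \<le> z * y" "0 < y" "0 < w" for x y z w :: real
    using that by (simp add: field_simps)
  ultimately show ?thesis
    unfolding whitham_factor_def using pos by (intro real_sqrt_le_mono) blast
qed

lemma whitham_factor_le_1: "0 < a \<Longrightarrow> a < b \<Longrightarrow> whitham_factor a b \<xi> \<le> 1"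
  using whitham_factor_antimono[of a b 0 \<xi>] by (simp add: whitham_factor_def)

text \<open>
  Expanding \<open>whitham_factor_eq\<close> gives a series in powers of \<open>laplace_symbol b\<close> with nonnegative
  coefficients, hence a positive multiplier. Even without its linear term, which is the one subtracted
  here, the series keeps this property; having the linear term available separately is what yields
  strict positivity of the kernel later.
\<close>

lemma pos_multiplier_whitham_factor_diff:
  assumes ab: "0 < a" "a < b"
  shows "pos_multiplier (\<lambda>\<xi>. whitham_factor a b \<xi> - a / b * (1 - a\<^sup>2 / b\<^sup>2) / 2 * laplace_symbol b \<xi>)"
proof -
  define p where "p = 1 - a\<^sup>2 / b\<^sup>2"
  have b: "b > 0" using ab by simp
  have "a\<^sup>2 < b\<^sup>2" using ab by (intro power_strict_mono) auto
  then have p: "0 < p" "p < 1" unfolding p_def using ab by (auto simp: field_simps)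
  define d where "d k = a / b * ((- 1 / 2 gchoose k) * (- 1) ^ k * p ^ k)" for k
  \<comment> \<open>The two sign alternations cancel, which makes all coefficients nonnegative.\<close>
  have gb: "(- 1 / 2 gchoose k) * (- 1 :: real) ^ k = pochhammer (1/2) k / fact k" for k
    by (simp add: gbinomial_pochhammer flip: power_mult_distrib)
  have d_nonneg: "0 \<le> d k" for k
    unfolding d_def gb using ab p by (intro mult_nonneg_nonneg divide_nonneg_nonneg) (auto intro: pochhammer_nonneg)
  have d1: "d 1 = a / b * p / 2" by (simp add: d_def)
  define e where "e k = (if k = 1 then 0 else d k)" for k
  have e_nonneg: "0 \<le> e k" for k using d_nonneg by (simp add: e_def)
  let ?R = "\<lambda>\<xi>. whitham_factor a b \<xi> - a / b * p / 2 * laplace_symbol b \<xi>"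
  have sums: "(\<lambda>k. e k * laplace_symbol b \<xi> ^ k) sums ?R \<xi>" for \<xi>
  proof -
    have l: "0 < laplace_symbol b \<xi>" "laplace_symbol b \<xi> \<le> 1" using laplace_symbol_bounds[OF b] by auto
    then have "p * laplace_symbol b \<xi> < 1" using p mult_left_le[of "laplace_symbol b \<xi>" p] by linarith
    then have small: "\<bar>- (p * laplace_symbol b \<xi>)\<bar> < 1" using l p by (simp add: abs_mult)
    have neg_power: "(- (p * laplace_symbol b \<xi>)) ^ k = (- 1) ^ k * (p * laplace_symbol b \<xi>) ^ k" for k
      by (simp flip: power_mult_distrib)
    from sums_mult[OF gen_binomial_real[OF small, of "- 1 / 2"], of "a / b"]
    have "(\<lambda>k. d k * laplace_symbol b \<xi> ^ k) sums whitham_factor a b \<xi>"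
      unfolding whitham_factor_eq[OF ab] d_def p_def[symmetric]
      by (simp add: neg_power power_mult_distrib mult_ac)
    from sums_diff[OF this sums_single[of 1 "\<lambda>k. d k * laplace_symbol b \<xi> ^ k"]]
    moreover have "(\<lambda>k. d k * laplace_symbol b \<xi> ^ k - (if k = 1 then d k * laplace_symbol b \<xi> ^ k else 0)) =
        (\<lambda>k. e k * laplace_symbol b \<xi> ^ k)"
      by (auto simp: e_def)
    ultimately show ?thesis by (simp add: d1[unfolded One_nat_def])
  qed
  have "pos_multiplier ?R"
  proof (rule pos_multiplier_limit)
    show "pos_multiplier (\<lambda>\<xi>. \<Sum>k<n. e k * laplace_symbol b \<xi> ^ k)" for n
      by (intro pos_multiplier_sum pos_multiplier_cmult pos_multiplier_power pos_multiplier_laplace e_nonneg b)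
    show "(\<lambda>n. \<Sum>k<n. e k * laplace_symbol b \<xi> ^ k) \<longlonglongrightarrow> ?R \<xi>" for \<xi>
      using sums by (simp add: sums_def)
    show "\<bar>\<Sum>k<n. e k * laplace_symbol b \<xi> ^ k\<bar> \<le> 1" for n \<xi>
    proof -
      have l: "0 < laplace_symbol b \<xi>" using laplace_symbol_bounds[OF b] by auto
      then have nn: "0 \<le> e k * laplace_symbol b \<xi> ^ k" for k using e_nonneg by simp
      then have "(\<Sum>k<n. e k * laplace_symbol b \<xi> ^ k) \<le> ?R \<xi>"
        using sum_le_suminf[of "\<lambda>k. e k * laplace_symbol b \<xi> ^ k" "{..<n}"] sums[of \<xi>]
        by (auto simp: sums_iff)
      also have "\<dots> \<le> 1" using whitham_factor_le_1[OF ab, of \<xi>] l p ab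
        by (smt (verit) divide_nonneg_nonneg mult_nonneg_nonneg)
      finally show ?thesis using nn by (simp add: sum_nonneg)
    qed
  qed
  then show ?thesis by (simp add: p_def)
qed

lemma pos_multiplier_whitham_factor:
  assumes ab: "0 < a" "a < b"
  shows "pos_multiplier (whitham_factor a b)"
proof -
  have "a\<^sup>2 / b\<^sup>2 \<le> 1" using ab by (simp add: power_mono)
  then have "0 \<le> a / b * (1 - a\<^sup>2 / b\<^sup>2) / 2" using ab by simp
  from pos_multiplier_add[OF pos_multiplier_whitham_factor_diff[OF ab]
      pos_multiplier_cmult[OF this pos_multiplier_laplace[of b]]]
  show ?thesis using ab by simp
qed

text \<open>
  Euler's product for the sine on the imaginary axis.
\<close>

lemma sinh_product:
  fixes x :: real
  assumes "x \<noteq> 0"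
  shows "(\<lambda>n. \<Prod>k=1..n. 1 + x\<^sup>2 / (real k * pi)\<^sup>2) \<longlonglongrightarrow> sinh x / x"
proof -
  have "(\<lambda>n. of_real pi * (\<i> * of_real (x / pi)) * (\<Prod>k=1..n. 1 - (\<i> * of_real (x / pi))\<^sup>2 / (of_nat k)\<^sup>2))
      \<longlonglongrightarrow> sin (of_real pi * (\<i> * complex_of_real (x / pi)))"
    by (rule sin_product_formula_complex)
  also have "of_real pi * (\<i> * complex_of_real (x / pi)) = \<i> * of_real x" by simp
  also have "sin (\<i> * complex_of_real x) = \<i> * of_real (sinh x)"
    by (simp add: sin_i_times sinh_field_def exp_of_real exp_minus)
  also have "(\<lambda>n. \<i> * of_real x * (\<Prod>k=1..n. 1 - (\<i> * complex_of_real (x / pi))\<^sup>2 / (of_nat k)\<^sup>2)) =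
      (\<lambda>n. \<i> * of_real x * of_real (\<Prod>k=1..n. 1 + x\<^sup>2 / (real k * pi)\<^sup>2))"
    by (simp add: power_mult_distrib power_divide mult.commute)
  finally have "(\<lambda>n. \<i> * of_real x * of_real (\<Prod>k=1..n. 1 + x\<^sup>2 / (real k * pi)\<^sup>2))
      \<longlonglongrightarrow> \<i> * complex_of_real (sinh x)" .
  from tendsto_divide[OF tendsto_Im[OF this] tendsto_const assms] show ?thesis
    using assms by (simp del: of_real_prod)
qed

text \<open>
  Since \<open>cosh \<xi> = sinh (2 \<xi>) / (2 sinh \<xi>)\<close>, the product for \<open>sinh\<close> gives
  \<open>tanh \<xi> / \<xi> = (sinh \<xi> / \<xi>)\<^sup>2 / (sinh (2 \<xi>) / (2 \<xi>))\<close> as a product over the zeros \<open>(k + 1) \<pi>\<close> and the poles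
  \<open>(k + 1/2) \<pi>\<close> of \<open>tan\<close>. As these interlace, each zero can be paired with the smaller pole next to
  it, and every square root of such a pair is a positive multiplier.
\<close>

lemma whitham_symbol_product:
  "(\<lambda>n. \<Prod>k<n. whitham_factor ((real k + 1/2) * pi) ((real k + 1) * pi) \<xi>) \<longlonglongrightarrow> whitham_symbol \<xi>"
proof (cases "\<xi> = 0")
  case True
  then show ?thesis by (simp add: whitham_symbol_def whitham_factor_def)
next
  case False
  define S where "S x n = (\<Prod>k=1..n. 1 + x\<^sup>2 / (real k * pi)\<^sup>2)" for x :: real and n :: nat
  have pos: "0 < 1 + x / c\<^sup>2" if "x \<ge> 0" for x c :: real using that by (intro add_pos_nonneg) auto
  have S_pos: "0 < S x n" for x n unfolding S_def by (intro prod_pos ballI pos) auto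
  \<comment> \<open>The even factors of the product for twice the argument cancel one of the two copies of the
    product for the argument; the odd ones provide the poles.\<close>
  have split: "(S \<xi> n)\<^sup>2 / S (2 * \<xi>) (2 * n) =
      (\<Prod>k<n. (1 + \<xi>\<^sup>2 / ((real k + 1) * pi)\<^sup>2) / (1 + \<xi>\<^sup>2 / ((real k + 1/2) * pi)\<^sup>2))" for n
  proof (induction n)
    case 0
    then show ?case by (simp add: S_def)
  next
    case (Suc n)
    define u v where "u = 1 + \<xi>\<^sup>2 / ((real n + 1) * pi)\<^sup>2" and "v = 1 + \<xi>\<^sup>2 / ((real n + 1/2) * pi)\<^sup>2"
    have uv: "u > 0" "v > 0" unfolding u_def v_def by (auto intro: pos)
    have "S \<xi> (Suc n) = S \<xi> n * u" by (simp add: S_def u_def add.commute)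
    moreover have "S (2 * \<xi>) (2 * Suc n) = S (2 * \<xi>) (2 * n) * v * u"
    proof -
      have "(real (2 * n + 1) * pi)\<^sup>2 = 4 * ((real n + 1/2) * pi)\<^sup>2"
        "(real (2 * n + 2) * pi)\<^sup>2 = 4 * ((real n + 1) * pi)\<^sup>2"
        by (simp_all add: power2_eq_square algebra_simps)
      then have "1 + (2 * \<xi>)\<^sup>2 / (real (2 * n + 1) * pi)\<^sup>2 = v" "1 + (2 * \<xi>)\<^sup>2 / (real (2 * n + 2) * pi)\<^sup>2 = u"
        unfolding u_def v_def by (simp_all only: power_mult_distrib) simp_all
      moreover have "2 * Suc n = Suc (Suc (2 * n))" by simp
      ultimately show ?thesis unfolding S_def by (simp del: of_nat_Suc mult_Suc_right)
    qed
    ultimately have "(S \<xi> (Suc n))\<^sup>2 / S (2 * \<xi>) (2 * Suc n) = (S \<xi> n)\<^sup>2 / S (2 * \<xi>) (2 * n) * (u / v)"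
      using uv S_pos[of "2 * \<xi>" "2 * n"] by (simp add: power2_eq_square field_simps)
    then show ?case unfolding Suc.IH by (simp add: u_def v_def)
  qed
  have "(\<lambda>n. S (2 * \<xi>) (2 * n)) \<longlonglongrightarrow> sinh (2 * \<xi>) / (2 * \<xi>)"
    using filterlim_compose[OF sinh_product[of "2 * \<xi>"], of "\<lambda>n. 2 * n" sequentially] False
    by (simp add: S_def filterlim_subseq strict_mono_def)
  moreover have "S \<xi> \<longlonglongrightarrow> sinh \<xi> / \<xi>" using sinh_product[OF False] by (simp add: S_def[abs_def])
  ultimately have "(\<lambda>n. (S \<xi> n)\<^sup>2 / S (2 * \<xi>) (2 * n)) \<longlonglongrightarrow> (sinh \<xi> / \<xi>)\<^sup>2 / (sinh (2 * \<xi>) / (2 * \<xi>))"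
    using False by (intro tendsto_intros) auto
  also have "(sinh \<xi> / \<xi>)\<^sup>2 / (sinh (2 * \<xi>) / (2 * \<xi>)) = tanh \<xi> / \<xi>"
    unfolding sinh_double using False by (simp add: tanh_def power2_eq_square field_simps)
  finally have "(\<lambda>n. sqrt ((S \<xi> n)\<^sup>2 / S (2 * \<xi>) (2 * n))) \<longlonglongrightarrow> whitham_symbol \<xi>"
    unfolding whitham_symbol_def using False by (auto intro: tendsto_real_sqrt)
  moreover have "sqrt (\<Prod>k<n. f k) = (\<Prod>k<n. sqrt (f k))" for f :: "nat \<Rightarrow> real" and n
    by (induction n) (auto simp: real_sqrt_mult)
  ultimately show ?thesis
    unfolding split by (simp add: whitham_factor_def)
qed

section \<open>Oscillatory integrals of decreasing functions\<close>

definition radially_decreasing :: "(real \<Rightarrow> real) \<Rightarrow> bool" where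
  "radially_decreasing g \<longleftrightarrow> (\<forall>\<xi> \<eta>. \<bar>\<xi>\<bar> \<le> \<bar>\<eta>\<bar> \<longrightarrow> 0 \<le> g \<eta> \<and> g \<eta> \<le> g \<xi>)"

lemma radially_decreasing_mult:
  assumes "radially_decreasing f" "radially_decreasing g"
  shows "radially_decreasing (\<lambda>\<xi>. f \<xi> * g \<xi>)"
  using assms unfolding radially_decreasing_def by (meson mult_mono mult_nonneg_nonneg order_trans)

lemma radially_decreasing_even: "radially_decreasing g \<Longrightarrow> g (- \<xi>) = g \<xi>"
  unfolding radially_decreasing_def by (intro antisym) auto

text \<open>
  By the second mean value theorem the integral of \<open>g f\<close> is a combination of two integrals of \<open>f\<close>
  alone, with coefficients \<open>g a\<close> and \<open>g b\<close>.
\<close>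

lemma decreasing_mult_integral_bound:
  fixes f g :: "real \<Rightarrow> real"
  assumes f: "\<And>u v. f integrable_on {u..v}" "\<And>u v. \<bar>integral {u..v} f\<bar> \<le> M"
    and g: "radially_decreasing g" and ab: "0 \<le> a" "a \<le> b"
  shows "(\<lambda>\<xi>. g \<xi> * f \<xi>) integrable_on {a..b}" "\<bar>integral {a..b} (\<lambda>\<xi>. g \<xi> * f \<xi>)\<bar> \<le> 2 * M * g a"
proof -
  have mono: "- g x \<le> - g y" if "a \<le> x" "x \<le> y" "y \<le> b" for x y
    using g ab that by (auto simp: radially_decreasing_def)
  obtain c where "((\<lambda>\<xi>. - g \<xi> * f \<xi>) has_integral - g a * integral {a..c} f + - g b * integral {c..b} f) {a..b}"
    using second_mean_value_theorem_full[OF f(1) ab(2), of "\<lambda>\<xi>. - g \<xi>"] mono by blast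
  from has_integral_neg[OF this]
  have I: "((\<lambda>\<xi>. g \<xi> * f \<xi>) has_integral g a * integral {a..c} f + g b * integral {c..b} f) {a..b}"
    by (simp add: add.commute)
  then show "(\<lambda>\<xi>. g \<xi> * f \<xi>) integrable_on {a..b}" by (rule has_integral_integrable)
  have gb: "0 \<le> g b" "g b \<le> g a" using g ab by (auto simp: radially_decreasing_def)
  have "\<bar>g a * integral {a..c} f + g b * integral {c..b} f\<bar> \<le> g a * M + g a * M"
    using abs_triangle_ineq[of "g a * integral {a..c} f" "g b * integral {c..b} f"]
      mult_mono[of "g a" "g a" "\<bar>integral {a..c} f\<bar>" M] mult_mono[of "g b" "g a" "\<bar>integral {c..b} f\<bar>" M] f(2) gb
    by (simp add: abs_mult algebra_simps)
  then show "\<bar>integral {a..b} (\<lambda>\<xi>. g \<xi> * f \<xi>)\<bar> \<le> 2 * M * g a"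
    using integral_unique[OF I] by (simp add: mult_ac)
qed

text \<open>
  A decreasing amplitude times an oscillation with bounded primitive has a conditionally convergent
  integral over the line. The error of truncation is controlled by the value of the amplitude at the
  truncation point only; the bound is therefore uniform when the amplitude is replaced by a smaller one.
\<close>

lemma oscillatory_integral:
  fixes f g :: "real \<Rightarrow> real"
  assumes f: "\<And>u v. f integrable_on {u..v}" "\<And>u v. \<bar>integral {u..v} f\<bar> \<le> M"
    and g: "radially_decreasing g" and lim: "(g \<longlongrightarrow> 0) at_top"
  shows "(\<lambda>\<xi>. g \<xi> * f \<xi>) integrable_on UNIV"
    and "0 < R \<Longrightarrow> \<bar>integral UNIV (\<lambda>\<xi>. g \<xi> * f \<xi>) - integral {-R..R} (\<lambda>\<xi>. g \<xi> * f \<xi>)\<bar> \<le> 4 * M * g R"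
proof -
  let ?h = "\<lambda>\<xi>. g \<xi> * f \<xi>"
  have f': "(\<lambda>\<xi>. f (- \<xi>)) integrable_on {u..v}" "\<bar>integral {u..v} (\<lambda>\<xi>. f (- \<xi>))\<bar> \<le> M" for u v
    using f(1)[of "-v" "-u"] f(2)[of "-v" "-u"]
      Henstock_Kurzweil_Integration.integrable_reflect_real[where f = f and a = "-v" and b = "-u"] Henstock_Kurzweil_Integration.integral_reflect_real[of "-u" "-v" f] by auto
  have right: "?h integrable_on {a..b}" "\<bar>integral {a..b} ?h\<bar> \<le> 2 * M * g a" if "0 \<le> a" "a \<le> b" for a b
    using decreasing_mult_integral_bound[OF f g that] by auto
  have left: "?h integrable_on {-b..-a}" "\<bar>integral {-b..-a} ?h\<bar> \<le> 2 * M * g a" if "0 \<le> a" "a \<le> b" for a b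
    using decreasing_mult_integral_bound[OF f' g that]
      Henstock_Kurzweil_Integration.integrable_reflect_real[where f = ?h and a = a and b = b] Henstock_Kurzweil_Integration.integral_reflect_real[of b a ?h]
      Henstock_Kurzweil_Integration.integrable_reflect_real[where f = "\<lambda>\<xi>. ?h (- \<xi>)" and a = a and b = b]
      Henstock_Kurzweil_Integration.integral_reflect_real[of b a "\<lambda>\<xi>. ?h (- \<xi>)"]
    by (auto simp: radially_decreasing_even[OF g])
  have int: "?h integrable_on {a..b}" for a b
  proof -
    define c where "c = max \<bar>a\<bar> \<bar>b\<bar>"
    have "?h integrable_on {-c..-0}" "?h integrable_on {0..c}" by (rule left right; simp add: c_def)+
    then have "?h integrable_on {-c..c}"
      by (intro Henstock_Kurzweil_Integration.integrable_combine[of "-c" 0 c]) (auto simp: c_def)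
    then show ?thesis by (rule integrable_on_subinterval) (auto simp: c_def)
  qed
  \<comment> \<open>The truncation point \<open>R\<close> is compared with arbitrary, possibly asymmetric, larger intervals,
    because these are the ones in the definition of the integral over the line.\<close>
  have near: "\<bar>integral {a..b} ?h - integral {-R..R} ?h\<bar> \<le> 4 * M * g R" if "0 < R" "a \<le> - R" "R \<le> b" for a b R
  proof -
    have "integral {a..-R} ?h + integral {-R..b} ?h = integral {a..b} ?h"
      using that int by (intro Henstock_Kurzweil_Integration.integral_combine) auto
    moreover have "integral {-R..R} ?h + integral {R..b} ?h = integral {-R..b} ?h"
      using that int by (intro Henstock_Kurzweil_Integration.integral_combine) auto
    moreover have "\<bar>integral {a..-R} ?h\<bar> \<le> 2 * M * g R" using left(2)[of R "-a"] that by simp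
    moreover have "\<bar>integral {R..b} ?h\<bar> \<le> 2 * M * g R" using right(2)[of R b] that by simp
    ultimately show ?thesis by linarith
  qed
  have ball: "a \<le> - R \<and> R \<le> b" if "ball 0 R \<subseteq> cbox a b" "0 < R" for a b R :: real
  proof -
    have "cball 0 R \<subseteq> cbox a b"
      using closure_minimal[OF that(1)] that(2) by (simp add: closure_ball)
    then have "-R \<in> cbox a b" "R \<in> cbox a b" using that(2) by (auto simp: subset_iff)
    then show ?thesis by simp
  qed
  have small: "\<exists>R>0. 4 * M * g R < e" if "0 < e" for e
  proof -
    have "((\<lambda>R. 4 * M * g R) \<longlongrightarrow> 4 * M * 0) at_top" by (intro tendsto_intros lim)
    then have "\<forall>\<^sub>F R in at_top. 4 * M * g R < e" by (rule order_tendstoD) (use that in simp)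
    with eventually_gt_at_top[of 0] have "\<forall>\<^sub>F R in at_top. 0 < R \<and> 4 * M * g R < e" by eventually_elim auto
    from eventually_happens'[OF trivial_limit_at_top_linorder this] show ?thesis by blast
  qed
  show I: "?h integrable_on UNIV"
  proof (subst integrable_alt, intro conjI allI impI)
    fix e :: real assume "0 < e"
    with small[of "e/2"] obtain R where R: "0 < R" "4 * M * g R < e / 2" by auto
    have "norm (integral (cbox a b) ?h - integral (cbox c d) ?h) < e"
      if "ball 0 R \<subseteq> cbox a b" "ball 0 R \<subseteq> cbox c d" for a b c d
    proof -
      have "\<bar>integral {a..b} ?h - integral {-R..R} ?h\<bar> \<le> 4 * M * g R"
        "\<bar>integral {c..d} ?h - integral {-R..R} ?h\<bar> \<le> 4 * M * g R"
        using near[OF R(1)] ball[OF that(1) R(1)] ball[OF that(2) R(1)] by auto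
      then show ?thesis using R(2) unfolding real_norm_def box_real by linarith
    qed
    then show "\<exists>B>0. \<forall>a b c d. ball 0 B \<subseteq> cbox a b \<and> ball 0 B \<subseteq> cbox c d \<longrightarrow>
        norm (integral (cbox a b) (\<lambda>x. if x \<in> UNIV then ?h x else 0) -
              integral (cbox c d) (\<lambda>x. if x \<in> UNIV then ?h x else 0)) < e"
      using R by auto
  qed (use int in auto)
  assume R: "0 < R"
  show "\<bar>integral UNIV ?h - integral {-R..R} ?h\<bar> \<le> 4 * M * g R"
  proof (rule field_le_epsilon)
    fix e :: real assume "0 < e"
    from integrable_integral[OF I] \<open>0 < e\<close> obtain B where B: "0 < B"
      "\<And>a b. ball 0 B \<subseteq> cbox a b \<Longrightarrow> norm (integral (cbox a b) ?h - integral UNIV ?h) < e"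
      unfolding has_integral_alt' by (auto split: if_splits)
    define b where "b = max B R"
    have "ball 0 B \<subseteq> cbox (-b) b" by (auto simp: b_def dist_real_def)
    from B(2)[OF this] have "\<bar>integral {-b..b} ?h - integral UNIV ?h\<bar> < e" by simp
    moreover have "\<bar>integral {-b..b} ?h - integral {-R..R} ?h\<bar> \<le> 4 * M * g R"
      by (rule near) (use R in \<open>auto simp: b_def\<close>)
    ultimately show "\<bar>integral UNIV ?h - integral {-R..R} ?h\<bar> \<le> 4 * M * g R + e" by linarith
  qed
qed

section \<open>Properties of the Whitham symbol\<close>

text \<open>
  Every factor of the product is decreasing in \<open>\<bar>\<xi>\<bar>\<close>, because \<open>a < b\<close>: the denominator
  grows faster than the numerator.
\<close>

lemma whitham_symbol_decreasing: "radially_decreasing whitham_symbol"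
  unfolding radially_decreasing_def
proof (intro allI impI conjI)
  fix \<xi> \<eta> :: real assume le: "\<bar>\<xi>\<bar> \<le> \<bar>\<eta>\<bar>"
  show "0 \<le> whitham_symbol \<eta>"
    by (rule LIMSEQ_le_const[OF whitham_symbol_product])
      (intro exI allI impI prod_nonneg less_imp_le whitham_factor_pos)
  show "whitham_symbol \<eta> \<le> whitham_symbol \<xi>"
  proof (rule LIMSEQ_le[OF whitham_symbol_product whitham_symbol_product], intro exI allI impI prod_mono conjI)
    fix k :: nat
    show "whitham_factor ((real k + 1/2) * pi) ((real k + 1) * pi) \<eta> \<le>
        whitham_factor ((real k + 1/2) * pi) ((real k + 1) * pi) \<xi>"
      using le by (intro whitham_factor_antimono) auto
  qed (auto intro: less_imp_le whitham_factor_pos)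
qed

lemma whitham_symbol_bounds: "0 < whitham_symbol \<xi>" "whitham_symbol \<xi> \<le> 1"
proof -
  have "0 < tanh \<xi> / \<xi>" if "\<xi> \<noteq> 0"
    using that by (cases \<xi> "0::real" rule: linorder_cases) (auto simp: divide_neg_neg)
  then show "0 < whitham_symbol \<xi>" by (simp add: whitham_symbol_def)
  show "whitham_symbol \<xi> \<le> 1"
    using whitham_symbol_decreasing[unfolded radially_decreasing_def, rule_format, of 0 \<xi>]
    by (simp add: whitham_symbol_def)
qed

lemma whitham_symbol_tendsto_0: "(whitham_symbol \<longlongrightarrow> 0) at_top"
proof (rule tendsto_sandwich[of "\<lambda>_. 0" _ _ "\<lambda>\<xi>. sqrt (1 / \<xi>)"])
  show "\<forall>\<^sub>F \<xi> in at_top. whitham_symbol \<xi> \<le> sqrt (1 / \<xi>)"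
    using eventually_gt_at_top[of 0]
    by eventually_elim
      (auto simp: whitham_symbol_def divide_right_mono less_imp_le[OF tanh_real_lt_1])
  have "((\<lambda>\<xi>::real. sqrt (1 / \<xi>)) \<longlongrightarrow> sqrt 0) at_top"
    by (intro tendsto_real_sqrt tendsto_divide_0[OF tendsto_const] filterlim_at_top_imp_at_infinity filterlim_ident)
  then show "((\<lambda>\<xi>::real. sqrt (1 / \<xi>)) \<longlongrightarrow> 0) at_top" by simp
qed (auto intro: always_eventually less_imp_le whitham_symbol_bounds)

lemma pos_multiplier_whitham_symbol: "pos_multiplier whitham_symbol"
proof (rule pos_multiplier_limit[OF _ _ whitham_symbol_product])
  fix n :: nat and \<xi> :: real
  show "pos_multiplier (\<lambda>\<xi>. \<Prod>k<n. whitham_factor ((real k + 1/2) * pi) ((real k + 1) * pi) \<xi>)"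
    by (intro pos_multiplier_prod pos_multiplier_whitham_factor) auto
  show "\<bar>\<Prod>k<n. whitham_factor ((real k + 1/2) * pi) ((real k + 1) * pi) \<xi>\<bar> \<le> 1"
    unfolding abs_prod
    by (intro prod_le_1) (auto intro!: whitham_factor_le_1 simp: less_imp_le whitham_factor_pos)
qed

text \<open>
  Only the first factor of the product is split, as its linear term \<open>c laplace_symbol b\<close> plus a positive
  multiplier; \<open>r\<close> is the product of all other factors. Up to a positive multiplier the symbol is thus a
  Laplace multiplier times \<open>r\<close>, to which \<open>cos_transform_laplace_lower\<close> applies.
\<close>

lemma whitham_symbol_split:
  obtains b c r where "b > 0" "c > 0" "pos_multiplier r" "\<And>\<xi>. whitham_symbol \<xi> \<le> r \<xi>"
    "pos_multiplier (\<lambda>\<xi>. whitham_symbol \<xi> - c * laplace_symbol b \<xi> * r \<xi>)"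
proof -
  define w where "w k = whitham_factor ((real k + 1/2) * pi) ((real k + 1) * pi)" for k
  define c where "c = pi / 2 / pi * (1 - (pi / 2)\<^sup>2 / pi\<^sup>2) / 2"
  define r where "r \<xi> = whitham_symbol \<xi> / w 0 \<xi>" for \<xi>
  have w: "0 < w k \<xi>" "w k \<xi> \<le> 1" "pos_multiplier (w k)" for k \<xi>
    unfolding w_def by (auto intro!: whitham_factor_pos whitham_factor_le_1 pos_multiplier_whitham_factor)
  have r: "pos_multiplier r"
  proof (rule pos_multiplier_limit)
    show "pos_multiplier (\<lambda>\<xi>. \<Prod>k<n. w (Suc k) \<xi>)" for n by (intro pos_multiplier_prod w)
    show "\<bar>\<Prod>k<n. w (Suc k) \<xi>\<bar> \<le> 1" for n \<xi>
      unfolding abs_prod by (intro prod_le_1) (use w in \<open>auto simp: less_imp_le\<close>)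
    show "(\<lambda>n. \<Prod>k<n. w (Suc k) \<xi>) \<longlonglongrightarrow> r \<xi>" for \<xi>
    proof -
      have "(\<lambda>n. (\<Prod>k<Suc n. w k \<xi>) / w 0 \<xi>) \<longlonglongrightarrow> whitham_symbol \<xi> / w 0 \<xi>"
        using LIMSEQ_Suc[OF whitham_symbol_product[of \<xi>]] w(1)[of 0 \<xi>]
        unfolding w_def by (intro tendsto_divide tendsto_const) auto
      then show ?thesis
        using w(1)[of 0 \<xi>] unfolding prod.lessThan_Suc_shift r_def by simp
    qed
  qed
  have w_r: "w 0 \<xi> * r \<xi> = whitham_symbol \<xi>" for \<xi>
    using w(1)[of 0 \<xi>] by (simp add: r_def)
  have "pos_multiplier (\<lambda>\<xi>. w 0 \<xi> - c * laplace_symbol pi \<xi>)"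
    using pos_multiplier_whitham_factor_diff[of "pi / 2" pi] by (simp add: w_def c_def)
  from pos_multiplier_mult[OF this r]
  have "pos_multiplier (\<lambda>\<xi>. (w 0 \<xi> - c * laplace_symbol pi \<xi>) * r \<xi>)" .
  also have "(\<lambda>\<xi>. (w 0 \<xi> - c * laplace_symbol pi \<xi>) * r \<xi>) =
      (\<lambda>\<xi>. whitham_symbol \<xi> - c * laplace_symbol pi \<xi> * r \<xi>)"
    unfolding left_diff_distrib by (simp add: w_r)
  finally have "pos_multiplier (\<lambda>\<xi>. whitham_symbol \<xi> - c * laplace_symbol pi \<xi> * r \<xi>)" .
  moreover have "whitham_symbol \<xi> \<le> r \<xi>" for \<xi>
    using w(1)[of 0 \<xi>] w(2)[of 0 \<xi>] whitham_symbol_bounds(1)[of \<xi>] unfolding r_def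
    by (simp add: pos_le_divide_eq mult_left_le)
  moreover have "c > 0" by (simp add: c_def power_divide)
  ultimately show ?thesis using r by (intro that[of pi c r]) auto
qed

section \<open>The Fejer weight\<close>

definition fejer_weight :: "real \<Rightarrow> real \<Rightarrow> real" where
  "fejer_weight R \<xi> = max 0 (1 - \<bar>\<xi>\<bar> / R)"

lemma fejer_weight_measurable [measurable]: "fejer_weight R \<in> borel_measurable borel"
  unfolding fejer_weight_def by measurable

lemma fejer_weight_bounds:
  assumes "0 < R"
  shows "0 \<le> fejer_weight R \<xi>" "fejer_weight R \<xi> \<le> 1" "\<bar>fejer_weight R \<xi> - 1\<bar> \<le> \<bar>\<xi>\<bar> / R"
  using assms by (auto simp: fejer_weight_def max_def)

lemma fejer_weight_eq_0: "0 < R \<Longrightarrow> R \<le> \<bar>\<xi>\<bar> \<Longrightarrow> fejer_weight R \<xi> = 0"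
  by (auto simp: fejer_weight_def max_def)

lemma fejer_weight_decreasing: "0 < R \<Longrightarrow> radially_decreasing (fejer_weight R)"
  by (auto simp: radially_decreasing_def fejer_weight_def max_def intro: order_trans divide_right_mono)

text \<open>
  The transform is the Fejer kernel \<open>2 (1 - cos (R y)) / (R y\<^sup>2)\<close>.
\<close>

lemma pos_def_weight_fejer:
  assumes R: "0 < R"
  shows "pos_def_weight (fejer_weight R)"
  unfolding pos_def_weight_def
proof (intro conjI allI)
  show int: "integrable lborel (fejer_weight R)"
    by (rule integrableI_bounded_set[where A = "{-R..R}" and B = 1])
      (use fejer_weight_bounds[OF R] fejer_weight_eq_0[OF R] in \<open>auto simp: emeasure_lborel_Icc_eq\<close>)
  fix y :: real
  show "0 \<le> cos_transform (fejer_weight R) y"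
  proof (cases "y = 0")
    case True
    then show ?thesis
      using fejer_weight_bounds[OF R] by (auto simp: cos_transform_def intro!: integral_nonneg)
  next
    case False
    define F where "F \<xi> = (1 - \<xi> / R) * sin (y * \<xi>) / y - cos (y * \<xi>) / (R * y\<^sup>2)" for \<xi>
    have "(F has_real_derivative (1 - \<xi> / R) * cos (y * \<xi>)) (at \<xi>)" for \<xi>
      unfolding F_def using R False
      by (auto intro!: derivative_eq_intros simp: power2_eq_square) (simp add: field_simps)
    then have FTC: "(LINT \<xi>|lborel. indicator {0..R} \<xi> *\<^sub>R ((1 - \<xi> / R) * cos (y * \<xi>))) = F R - F 0"
      using R by (intro integral_FTC_Icc)
        (auto intro!: continuous_intros simp: has_real_derivative_iff_has_vector_derivative
          intro: has_vector_derivative_at_within)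
    have "cos_transform (fejer_weight R) y =
        2 * (LINT \<xi>|lborel. indicator {0..} \<xi> * (fejer_weight R \<xi> * cos (y * \<xi>)))"
      unfolding cos_transform_def
      by (rule even_lborel_integral[OF integrable_mult_cos[OF int]]) (simp add: fejer_weight_def)
    also have "(LINT \<xi>|lborel. indicator {0..} \<xi> * (fejer_weight R \<xi> * cos (y * \<xi>))) =
        (LINT \<xi>|lborel. indicator {0..R} \<xi> *\<^sub>R ((1 - \<xi> / R) * cos (y * \<xi>)))"
      using R by (intro Bochner_Integration.integral_cong refl) (auto simp: fejer_weight_def max_def indicator_def)
    also have "\<dots> = (1 - cos (y * R)) / (R * y\<^sup>2)"
      unfolding FTC using R by (simp add: F_def diff_divide_distrib)
    finally show ?thesis using R by simp
  qed
qed

section \<open>Fejer means of the Whitham kernel\<close>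

lemma trig_integral_bounds:
  fixes x u v :: real
  assumes "x \<noteq> 0"
  shows "(\<lambda>\<xi>. cos (x * \<xi>)) integrable_on {u..v}" "\<bar>integral {u..v} (\<lambda>\<xi>. cos (x * \<xi>))\<bar> \<le> 2 / \<bar>x\<bar>"
    and "(\<lambda>\<xi>. sin (x * \<xi>)) integrable_on {u..v}" "\<bar>integral {u..v} (\<lambda>\<xi>. sin (x * \<xi>))\<bar> \<le> 2 / \<bar>x\<bar>"
proof -
  show "(\<lambda>\<xi>. cos (x * \<xi>)) integrable_on {u..v}" "(\<lambda>\<xi>. sin (x * \<xi>)) integrable_on {u..v}"
    by (intro integrable_continuous_real continuous_intros)+
  show "\<bar>integral {u..v} (\<lambda>\<xi>. cos (x * \<xi>))\<bar> \<le> 2 / \<bar>x\<bar>"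
  proof (cases "u \<le> v")
    case True
    have "((\<lambda>\<xi>. cos (x * \<xi>)) has_integral sin (x * v) / x - sin (x * u) / x) {u..v}"
      using True assms by (intro fundamental_theorem_of_calculus)
        (auto intro!: derivative_eq_intros simp flip: has_real_derivative_iff_has_vector_derivative)
    then have "integral {u..v} (\<lambda>\<xi>. cos (x * \<xi>)) = (sin (x * v) - sin (x * u)) / x"
      by (simp add: integral_unique diff_divide_distrib)
    moreover have "\<bar>sin (x * v) - sin (x * u)\<bar> \<le> 2"
      using abs_sin_le_one[of "x * v"] abs_sin_le_one[of "x * u"] by linarith
    ultimately show ?thesis by (simp add: divide_right_mono)
  qed simp
  show "\<bar>integral {u..v} (\<lambda>\<xi>. sin (x * \<xi>))\<bar> \<le> 2 / \<bar>x\<bar>"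
  proof (cases "u \<le> v")
    case True
    have "((\<lambda>\<xi>. sin (x * \<xi>)) has_integral - cos (x * v) / x - (- cos (x * u) / x)) {u..v}"
      using True assms by (intro fundamental_theorem_of_calculus)
        (auto intro!: derivative_eq_intros simp flip: has_real_derivative_iff_has_vector_derivative)
    then have "integral {u..v} (\<lambda>\<xi>. sin (x * \<xi>)) = (cos (x * u) - cos (x * v)) / x"
      by (simp add: integral_unique diff_divide_distrib)
    moreover have "\<bar>cos (x * u) - cos (x * v)\<bar> \<le> 2"
      using abs_cos_le_one[of "x * v"] abs_cos_le_one[of "x * u"] by linarith
    ultimately show ?thesis by (simp add: divide_right_mono)
  qed simp
qed

text \<open>
  The sine part of the inversion integral converges as well, so the complex integral splits into its
  real and imaginary parts.
\<close>

lemma whitham_kernel_eq: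
  assumes x: "x \<noteq> 0"
  shows "whitham_kernel x = integral UNIV (\<lambda>\<xi>. whitham_symbol \<xi> * cos (x * \<xi>)) / (2 * pi)"
proof -
  let ?C = "integral UNIV (\<lambda>\<xi>. whitham_symbol \<xi> * cos (x * \<xi>))"
  let ?S = "integral UNIV (\<lambda>\<xi>. whitham_symbol \<xi> * sin (x * \<xi>))"
  have c: "((\<lambda>\<xi>. whitham_symbol \<xi> * cos (x * \<xi>)) has_integral ?C) UNIV"
    by (intro integrable_integral oscillatory_integral(1)[OF trig_integral_bounds(1,2)[OF x]]
        whitham_symbol_decreasing whitham_symbol_tendsto_0)
  have s: "((\<lambda>\<xi>. whitham_symbol \<xi> * sin (x * \<xi>)) has_integral ?S) UNIV"
    by (intro integrable_integral oscillatory_integral(1)[OF trig_integral_bounds(3,4)[OF x]]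
        whitham_symbol_decreasing whitham_symbol_tendsto_0)
  have "((\<lambda>\<xi>. of_real (whitham_symbol \<xi> * cos (x * \<xi>)) + \<i> * of_real (whitham_symbol \<xi> * sin (x * \<xi>)))
      has_integral (of_real ?C + \<i> * of_real ?S)) UNIV"
    by (intro has_integral_add has_integral_mult_right has_integral_of_real c s)
  also have "(\<lambda>\<xi>. of_real (whitham_symbol \<xi> * cos (x * \<xi>)) + \<i> * of_real (whitham_symbol \<xi> * sin (x * \<xi>))) =
      (\<lambda>\<xi>::real. complex_of_real (whitham_symbol \<xi>) * exp (\<i> * of_real x * of_real \<xi>))"
    by (auto simp: fun_eq_iff complex_eq_iff Re_exp Im_exp)
  finally have "integral UNIV (\<lambda>\<xi>::real. complex_of_real (whitham_symbol \<xi>) * exp (\<i> * of_real x * of_real \<xi>)) =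
      of_real ?C + \<i> * of_real ?S"
    by (rule integral_unique)
  then have "whitham_kernel x = Re (1 / (2 * of_real pi) * (of_real ?C + \<i> * of_real ?S))"
    by (simp only: whitham_kernel_def)
  also have "1 / (2 * complex_of_real pi) = of_real (1 / (2 * pi))" by simp
  also have "Re (of_real (1 / (2 * pi)) * (of_real ?C + \<i> * of_real ?S)) = ?C / (2 * pi)"
    by (simp del: of_real_divide)
  finally show ?thesis .
qed

text \<open>
  A compactly supported truncation of the symbol. It is an integrable weight with nonnegative transform,
  and its transforms approximate the kernel.
\<close>

definition whitham_mean :: "nat \<Rightarrow> real \<Rightarrow> real" where
  "whitham_mean n \<xi> = whitham_symbol \<xi> * fejer_weight (real (Suc n)) \<xi>"

lemma pos_def_weight_whitham_mean: "pos_def_weight (whitham_mean n)"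
  unfolding whitham_mean_def[abs_def]
  by (intro pos_multiplier_weight pos_multiplier_whitham_symbol pos_def_weight_fejer) simp

lemma whitham_mean_bounds:
  "0 \<le> whitham_mean n \<xi>" "whitham_mean n \<xi> \<le> 1" "real (Suc n) \<le> \<bar>\<xi>\<bar> \<Longrightarrow> whitham_mean n \<xi> = 0"
  "whitham_mean n \<xi> \<le> whitham_symbol \<xi>" "\<bar>whitham_mean n \<xi> - whitham_symbol \<xi>\<bar> \<le> \<bar>\<xi>\<bar> / real (Suc n)"
proof -
  have R: "0 < real (Suc n)" by simp
  note w = whitham_symbol_bounds[of \<xi>] and f = fejer_weight_bounds[OF R, of \<xi>]
  show "0 \<le> whitham_mean n \<xi>" "whitham_mean n \<xi> \<le> 1" "whitham_mean n \<xi> \<le> whitham_symbol \<xi>"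
    using w f by (auto simp: whitham_mean_def intro: mult_le_one mult_left_le)
  show "real (Suc n) \<le> \<bar>\<xi>\<bar> \<Longrightarrow> whitham_mean n \<xi> = 0"
    using fejer_weight_eq_0[OF R] by (simp add: whitham_mean_def)
  have "whitham_mean n \<xi> - whitham_symbol \<xi> = whitham_symbol \<xi> * (fejer_weight (real (Suc n)) \<xi> - 1)"
    by (simp add: whitham_mean_def algebra_simps)
  moreover have "whitham_symbol \<xi> * \<bar>fejer_weight (real (Suc n)) \<xi> - 1\<bar> \<le> 1 * (\<bar>\<xi>\<bar> / real (Suc n))"
    using w f by (intro mult_mono) auto
  ultimately show "\<bar>whitham_mean n \<xi> - whitham_symbol \<xi>\<bar> \<le> \<bar>\<xi>\<bar> / real (Suc n)"
    using w by (simp add: abs_mult)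
qed

lemma whitham_mean_decreasing: "radially_decreasing (whitham_mean n)"
  unfolding whitham_mean_def[abs_def]
  by (intro radially_decreasing_mult whitham_symbol_decreasing fejer_weight_decreasing) simp

text \<open>
  Both the symbol and its truncations are decreasing, so \<open>oscillatory_integral\<close> bounds all their tails
  beyond \<open>R\<close> by the value of the symbol at \<open>R\<close>, uniformly in \<open>n\<close>. On the bounded interval that remains,
  the truncations converge uniformly to the symbol.
\<close>

lemma whitham_kernel_tendsto:
  assumes x: "x \<noteq> 0"
  shows "(\<lambda>n. cos_transform (whitham_mean n) x) \<longlonglongrightarrow> 2 * pi * whitham_kernel x"
proof (rule LIMSEQ_I)
  fix e :: real assume e: "0 < e"
  define M where "M = 2 / \<bar>x\<bar>"
  let ?c = "\<lambda>\<xi>. cos (x * \<xi>)"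
  have f: "?c integrable_on {u..v}" "\<bar>integral {u..v} ?c\<bar> \<le> M" for u v
    using trig_integral_bounds(1,2)[OF x] by (auto simp: M_def)
  have M: "0 \<le> M" by (simp add: M_def)
  have "((\<lambda>R. 4 * M * whitham_symbol R) \<longlongrightarrow> 4 * M * 0) at_top" by (intro tendsto_intros whitham_symbol_tendsto_0)
  then have "\<forall>\<^sub>F R in at_top. 4 * M * whitham_symbol R < e / 4" by (rule order_tendstoD) (use e in simp)
  with eventually_gt_at_top[of 0] have "\<forall>\<^sub>F R in at_top. 0 < R \<and> 4 * M * whitham_symbol R < e / 4"
    by eventually_elim auto
  from eventually_happens'[OF trivial_limit_at_top_linorder this]
  obtain R where R: "0 < R" "4 * M * whitham_symbol R < e / 4" by blast
  \<comment> \<open>The length \<open>2 R\<close> of the interval times the bound \<open>R / (n + 1)\<close> on the difference there becomes less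
    than \<open>e / 2\<close>.\<close>
  obtain N :: nat where N: "4 * R\<^sup>2 / e < real N" using reals_Archimedean2 by blast
  let ?K = "\<lambda>\<xi>. whitham_symbol \<xi> * ?c \<xi>"
  have K: "\<bar>integral UNIV ?K - integral {-R..R} ?K\<bar> < e / 4"
    using oscillatory_integral(2)[OF f whitham_symbol_decreasing whitham_symbol_tendsto_0 R(1)] R by linarith
  have iK: "?K integrable_on {-R..R}"
    using oscillatory_integral(1)[OF f whitham_symbol_decreasing whitham_symbol_tendsto_0]
    by (rule integrable_on_subinterval) auto
  have "norm (cos_transform (whitham_mean n) x - 2 * pi * whitham_kernel x) < e" if "n \<ge> N" for n
  proof -
    let ?h = "\<lambda>\<xi>. whitham_mean n \<xi> * ?c \<xi>"
    have "integrable lborel (whitham_mean n)" using pos_def_weight_whitham_mean by (simp add: pos_def_weight_def)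
    then have T: "cos_transform (whitham_mean n) x = integral UNIV ?h"
      unfolding cos_transform_def using integral_lborel[OF integrable_mult_cos] by simp
    have "\<forall>\<^sub>F \<xi> in at_top. whitham_mean n \<xi> = 0"
      using eventually_ge_at_top[of "real (Suc n)"] by eventually_elim (auto intro: whitham_mean_bounds(3))
    then have lim: "(whitham_mean n \<longlongrightarrow> 0) at_top" by (rule tendsto_eventually)
    have "4 * M * whitham_mean n R \<le> 4 * M * whitham_symbol R"
      using whitham_mean_bounds(4) M by (intro mult_left_mono) auto
    then have h: "\<bar>integral UNIV ?h - integral {-R..R} ?h\<bar> < e / 4"
      using oscillatory_integral(2)[OF f whitham_mean_decreasing[of n] lim R(1)] R by linarith
    have ih: "?h integrable_on {-R..R}"
      using oscillatory_integral(1)[OF f whitham_mean_decreasing lim] by (rule integrable_on_subinterval) auto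
    have "norm (integral {-R..R} (\<lambda>\<xi>. ?h \<xi> - ?K \<xi>)) \<le> R / real (Suc n) * measure lborel {-R..R}"
    proof (rule has_integral_bound_real[OF _ finite.emptyI integrable_integral])
      show "(\<lambda>\<xi>. ?h \<xi> - ?K \<xi>) integrable_on {-R..R}" using ih iK by (rule integrable_diff)
      fix \<xi> assume "\<xi> \<in> {-R..R} - {}"
      then have "\<bar>\<xi>\<bar> / real (Suc n) \<le> R / real (Suc n)" by (intro divide_right_mono) auto
      then have "\<bar>whitham_mean n \<xi> - whitham_symbol \<xi>\<bar> \<le> R / real (Suc n)"
        using whitham_mean_bounds(5)[of n \<xi>] by linarith
      moreover have "\<bar>?h \<xi> - ?K \<xi>\<bar> \<le> \<bar>whitham_mean n \<xi> - whitham_symbol \<xi>\<bar>"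
        unfolding left_diff_distrib[symmetric] abs_mult by (simp add: mult_left_le)
      ultimately show "norm (?h \<xi> - ?K \<xi>) \<le> R / real (Suc n)" by simp
    qed (use R in auto)
    also have "R / real (Suc n) * measure lborel {-R..R} = 2 * R\<^sup>2 / real (Suc n)"
      using R by (simp add: power2_eq_square)
    also have "\<dots> < e / 2"
    proof -
      have "4 * R\<^sup>2 / e < real (Suc n)" using N that by linarith
      then show ?thesis using e by (simp add: field_simps)
    qed
    finally have "\<bar>integral {-R..R} ?h - integral {-R..R} ?K\<bar> < e / 2"
      by (simp add: integral_diff[OF ih iK])
    moreover have "2 * pi * whitham_kernel x = integral UNIV ?K" by (simp add: whitham_kernel_eq[OF x])
    ultimately show ?thesis using K h unfolding T real_norm_def by linarith
  qed
  then show "\<exists>N. \<forall>n\<ge>N. norm (cos_transform (whitham_mean n) x - 2 * pi * whitham_kernel x) < e" by blast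
qed

section \<open>Positivity and mass of the Whitham kernel\<close>

lemma whitham_kernel_measurable [measurable]: "whitham_kernel \<in> borel_measurable borel"
proof (rule borel_measurable_LIMSEQ_real)
  fix x :: real
  show "(\<lambda>n. if x = 0 then whitham_kernel 0 else cos_transform (whitham_mean n) x / (2 * pi)) \<longlonglongrightarrow> whitham_kernel x"
    using tendsto_divide[OF whitham_kernel_tendsto tendsto_const, of x "2 * pi"] by (cases "x = 0") auto
next
  fix n
  have "whitham_mean n \<in> borel_measurable borel"
    using pos_def_weight_whitham_mean[of n] by (auto simp: pos_def_weight_def dest: borel_measurable_integrable)
  then have [measurable]: "cos_transform (whitham_mean n) \<in> borel_measurable borel"
    by (rule cos_transform_measurable)
  show "(\<lambda>x. if x = 0 then whitham_kernel 0 else cos_transform (whitham_mean n) x / (2 * pi)) \<in> borel_measurable borel"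
    by measurable
qed

text \<open>
  Being a limit of nonnegative transforms, the kernel is nonnegative. For strict positivity the
  truncated symbol is bounded below, up to a positive multiplier, by \<open>c laplace_symbol b \<cdot> r\<close> times the
  Fejer weight. The transform of this part is at least \<open>exp (- b \<bar>x\<bar>)\<close> times its integral, and that
  integral is bounded below independently of the truncation by its contribution from \<open>{0..1}\<close>.
\<close>

lemma whitham_kernel_pos:
  assumes x: "x \<noteq> 0"
  shows "0 < whitham_kernel x"
proof -
  obtain b c r where b: "b > 0" and c: "c > 0" and r: "pos_multiplier r" "\<And>\<xi>. whitham_symbol \<xi> \<le> r \<xi>"
    and diff: "pos_multiplier (\<lambda>\<xi>. whitham_symbol \<xi> - c * laplace_symbol b \<xi> * r \<xi>)"
    using whitham_symbol_split by metis
  define d where "d = c * (exp (- b * \<bar>x\<bar>) * (laplace_symbol b 1 * (whitham_symbol 1 / 2)))"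
  have d: "0 < d"
    unfolding d_def using b c whitham_symbol_bounds(1) laplace_symbol_bounds(1)[OF b] by simp
  have "d \<le> cos_transform (whitham_mean n) x" if n: "n \<ge> 1" for n
  proof -
    let ?F = "fejer_weight (real (Suc n))"
    let ?h = "\<lambda>\<xi>. r \<xi> * ?F \<xi>"
    have F: "pos_def_weight ?F" by (rule pos_def_weight_fejer) simp
    have Fnn: "0 \<le> ?F \<xi>" for \<xi> by (rule fejer_weight_bounds) simp
    have h: "pos_def_weight ?h" by (rule pos_multiplier_weight[OF r(1) F])
    then have ih: "integrable lborel ?h" by (simp add: pos_def_weight_def)
    have ilh: "integrable lborel (\<lambda>\<xi>. laplace_symbol b \<xi> * ?h \<xi>)"
      using pos_multiplier_integrable[OF pos_multiplier_laplace[OF b] ih] .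
    have hnn: "0 \<le> ?h \<xi>" for \<xi>
      using Fnn r(2)[of \<xi>] whitham_symbol_bounds(1)[of \<xi>] by simp
    have "laplace_symbol b 1 * (whitham_symbol 1 / 2) =
        (LINT \<xi>|lborel. indicator {0..1::real} \<xi> * (laplace_symbol b 1 * (whitham_symbol 1 / 2)))"
      by simp
    also have "\<dots> \<le> (LINT \<xi>|lborel. laplace_symbol b \<xi> * ?h \<xi>)"
    proof (rule integral_mono)
      fix \<xi> :: real
      show "indicator {0..1} \<xi> * (laplace_symbol b 1 * (whitham_symbol 1 / 2)) \<le> laplace_symbol b \<xi> * ?h \<xi>"
      proof (cases "\<xi> \<in> {0..1}")
        case True
        have "laplace_symbol b 1 \<le> laplace_symbol b \<xi>"
          unfolding laplace_symbol_def using b True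
          by (intro divide_left_mono mult_pos_pos add_pos_nonneg) (auto simp: power_le_one)
        moreover have "whitham_symbol 1 \<le> r \<xi>"
          using whitham_symbol_decreasing[unfolded radially_decreasing_def, rule_format, of \<xi> 1] r(2)[of \<xi>] True
          by auto
        moreover have "1 / 2 \<le> ?F \<xi>"
        proof -
          have "\<xi> / real (Suc n) \<le> 1 / 2" using True n by (intro frac_le) auto
          then show ?thesis using True by (simp add: fejer_weight_def)
        qed
        ultimately have "laplace_symbol b 1 * (whitham_symbol 1 * (1 / 2)) \<le> laplace_symbol b \<xi> * ?h \<xi>"
          using whitham_symbol_bounds(1)[of 1] laplace_symbol_bounds(1)[OF b, of 1]
            laplace_symbol_bounds(1)[OF b, of \<xi>] r(2)[of \<xi>]
          by (intro mult_mono) auto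
        then show ?thesis using True by simp
      next
        case False
        then show ?thesis using hnn[of \<xi>] laplace_symbol_bounds(1)[OF b, of \<xi>] by simp
      qed
    qed (use ilh in auto)
    also have "exp (- b * \<bar>x\<bar>) * \<dots> \<le> cos_transform (\<lambda>\<xi>. laplace_symbol b \<xi> * ?h \<xi>) x"
      by (rule cos_transform_laplace_lower[OF b h])
    finally have "exp (- b * \<bar>x\<bar>) * (laplace_symbol b 1 * (whitham_symbol 1 / 2)) \<le>
        cos_transform (\<lambda>\<xi>. laplace_symbol b \<xi> * ?h \<xi>) x"
      by simp
    then have "d \<le> cos_transform (\<lambda>\<xi>. c * (laplace_symbol b \<xi> * ?h \<xi>)) x"
      unfolding d_def cos_transform_cmult using c by (intro mult_left_mono) auto
    also have "\<dots> \<le> \<dots> + cos_transform (\<lambda>\<xi>. (whitham_symbol \<xi> - c * laplace_symbol b \<xi> * r \<xi>) * ?F \<xi>) x"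
      using pos_multiplier_weight[OF diff F] by (simp add: pos_def_weight_def)
    also have "\<dots> = cos_transform (\<lambda>\<xi>. c * (laplace_symbol b \<xi> * ?h \<xi>) +
        (whitham_symbol \<xi> - c * laplace_symbol b \<xi> * r \<xi>) * ?F \<xi>) x"
      using pos_multiplier_weight[OF diff F] ilh
      by (intro cos_transform_add[symmetric]) (auto simp: pos_def_weight_def)
    also have "(\<lambda>\<xi>. c * (laplace_symbol b \<xi> * ?h \<xi>) +
        (whitham_symbol \<xi> - c * laplace_symbol b \<xi> * r \<xi>) * ?F \<xi>) = whitham_mean n"
      by (simp add: fun_eq_iff whitham_mean_def algebra_simps)
    finally show ?thesis .
  qed
  then have "d \<le> 2 * pi * whitham_kernel x"
    using whitham_kernel_tendsto[OF x] by (intro LIMSEQ_le_const) auto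
  with d have "0 < 2 * pi * whitham_kernel x" by linarith
  then show ?thesis by (simp add: zero_less_mult_iff)
qed

text \<open>
  By Parseval's identity the damped integral of the transform equals the integral of the truncated
  symbol, which is at most 1, against \<open>2 d / (d\<^sup>2 + u\<^sup>2)\<close>, whose total integral is \<open>2 \<pi>\<close>.
\<close>

lemma integral_damped_transform_le:
  "(LINT y|lborel. cos_transform (whitham_mean n) y * exp (- (1 / real (Suc n)) * \<bar>y\<bar>)) \<le> 2 * pi"
  "integrable lborel (\<lambda>y. cos_transform (whitham_mean n) y * exp (- (1 / real (Suc n)) * \<bar>y\<bar>))"
proof -
  define d R where "d = 1 / real (Suc n)" and "R = real (Suc n)"
  have d: "0 < d" and R: "0 < R" by (auto simp: d_def R_def)
  have i: "integrable lborel (whitham_mean n)" using pos_def_weight_whitham_mean by (simp add: pos_def_weight_def)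
  then have [measurable]: "whitham_mean n \<in> borel_measurable borel" by (auto dest: borel_measurable_integrable)
  let ?P = "\<lambda>u. 2 * d / (d\<^sup>2 + u\<^sup>2)"
  have "((\<lambda>u. 2 * arctan (u / d)) has_real_derivative ?P u) (at u)" for u
    using d by (auto intro!: derivative_eq_intros simp: field_simps power2_eq_square)
  note der = this
  have pos: "0 < d\<^sup>2 + u\<^sup>2" for u using d by (intro add_pos_nonneg) auto
  have int: "integrable lborel (\<lambda>u. ?P u * indicator {-R..R} u)"
    and eq: "(LINT u|lborel. ?P u * indicator {-R..R} u) = 2 * arctan (R / d) - 2 * arctan (- R / d)"
    using integrable_FTC_Icc_nonneg[where f = ?P and F = "\<lambda>u. 2 * arctan (u / d)" and a = "-R" and b = R]
      integral_FTC_Icc_nonneg[where f = ?P and F = "\<lambda>u. 2 * arctan (u / d)" and a = "-R" and b = R]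
      d R der pos by (simp_all add: less_imp_le)
  show "integrable lborel (\<lambda>y. cos_transform (whitham_mean n) y * exp (- (1 / real (Suc n)) * \<bar>y\<bar>))"
    unfolding d_def[symmetric]
    by (rule integrable_mult_bounded(1)[OF integrable_exp_abs[OF d] _ abs_cos_transform_le[OF i]]) simp
  have half: "(t + t) / 2 = t" for t :: real by simp
  have "(LINT y|lborel. cos_transform (whitham_mean n) y * exp (- d * \<bar>y\<bar>)) =
      cos_transform (\<lambda>y. cos_transform (whitham_mean n) y * exp (- d * \<bar>y\<bar>)) 0"
    by (simp add: cos_transform_def[of _ 0])
  also have "\<dots> = (LINT u|lborel. whitham_mean n u * ?P u)"
    unfolding cos_transform_mult_cos_transform[OF integrable_exp_abs[OF d] i]
    by (simp only: add_0_right diff_zero cos_transform_exp_abs[OF d] half)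
  also have "\<dots> \<le> (LINT u|lborel. ?P u * indicator {-R..R} u)"
  proof (rule integral_mono)
    show "integrable lborel (\<lambda>u. whitham_mean n u * ?P u)"
    proof (rule integrable_mult_bounded(2)[OF i])
      fix u :: real
      have "?P u \<le> 2 * d / d\<^sup>2" using d pos[of u] by (intro divide_left_mono) auto
      then show "\<bar>?P u\<bar> \<le> 2 * d / d\<^sup>2" using d pos[of u] by simp
    qed measurable
    fix u :: real
    have "whitham_mean n u * ?P u \<le> 1 * ?P u"
      using whitham_mean_bounds(2)[of n u] pos[of u] d by (intro mult_right_mono) auto
    then show "whitham_mean n u * ?P u \<le> ?P u * indicator {-R..R} u"
      using whitham_mean_bounds(3)[of n u] by (cases "u \<in> {-R..R}") (auto simp: R_def abs_le_iff not_le)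
  qed (rule int)
  also have "\<dots> \<le> 2 * pi" unfolding eq using arctan_bounded[of "R / d"] by (simp add: arctan_minus)
  finally show "(LINT y|lborel. cos_transform (whitham_mean n) y * exp (- (1 / real (Suc n)) * \<bar>y\<bar>)) \<le> 2 * pi"
    unfolding d_def .
qed

lemma whitham_kernel_AE_pos: "AE y in lborel. 0 < whitham_kernel (x - y)"
  using AE_lborel_singleton[of x] by eventually_elim (auto intro: whitham_kernel_pos)

text \<open>
  Fatou's lemma for the damped Fejer means: they are nonnegative, their integrals are at most \<open>2 \<pi>\<close>, and
  they converge to \<open>2 \<pi>\<close> times the kernel away from 0. Mass at most 1 is what the comparison argument
  uses, since the constant that is compared there is negative.
\<close>

lemma
  shows whitham_kernel_integrable: "integrable lborel whitham_kernel"
    and whitham_kernel_integral_le_1: "(LINT y|lborel. whitham_kernel y) \<le> 1"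
proof -
  let ?f = "\<lambda>n y. cos_transform (whitham_mean n) y * exp (- (1 / real (Suc n)) * \<bar>y\<bar>)"
  have nn: "0 \<le> ?f n y" for n y using pos_def_weight_whitham_mean by (simp add: pos_def_weight_def)
  have lim: "(\<lambda>n. ennreal (?f n y)) \<longlonglongrightarrow> ennreal (2 * pi * whitham_kernel y)" if "y \<noteq> 0" for y
  proof (intro tendsto_ennrealI)
    have "(\<lambda>n. exp (- (1 / real (Suc n)) * \<bar>y\<bar>)) \<longlonglongrightarrow> exp (- 0 * \<bar>y\<bar>)"
      by (intro tendsto_intros LIMSEQ_Suc[OF lim_1_over_n])
    from tendsto_mult[OF whitham_kernel_tendsto[OF that] this]
    show "(\<lambda>n. ?f n y) \<longlonglongrightarrow> 2 * pi * whitham_kernel y" by simp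
  qed
  have pos: "AE y in lborel. 0 \<le> whitham_kernel y"
    using AE_lborel_singleton[of 0] by eventually_elim (auto intro: less_imp_le whitham_kernel_pos)
  have "(\<integral>\<^sup>+y. ennreal (2 * pi * whitham_kernel y) \<partial>lborel) = (\<integral>\<^sup>+y. liminf (\<lambda>n. ennreal (?f n y)) \<partial>lborel)"
  proof (rule nn_integral_cong_AE)
    show "AE y in lborel. ennreal (2 * pi * whitham_kernel y) = liminf (\<lambda>n. ennreal (?f n y))"
      using AE_lborel_singleton[of 0]
    proof eventually_elim
      case (elim y)
      then show ?case using lim_imp_Liminf[OF _ lim[of y]] by simp
    qed
  qed
  also have "\<dots> \<le> liminf (\<lambda>n. \<integral>\<^sup>+y. ennreal (?f n y) \<partial>lborel)"
    using integral_damped_transform_le(2) by (intro nn_integral_liminf) (auto dest: borel_measurable_integrable)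
  also have "\<dots> \<le> ennreal (2 * pi)"
  proof (rule Liminf_le)
    show "\<forall>\<^sub>F n in sequentially. (\<integral>\<^sup>+y. ennreal (?f n y) \<partial>lborel) \<le> ennreal (2 * pi)"
      using integral_damped_transform_le nn
      by (intro always_eventually allI) (subst nn_integral_eq_integral, auto intro: ennreal_leI)
  qed simp
  finally have bound: "(\<integral>\<^sup>+y. ennreal (2 * pi * whitham_kernel y) \<partial>lborel) \<le> ennreal (2 * pi)" .
  have pos2: "AE y in lborel. 0 \<le> 2 * pi * whitham_kernel y" using pos by eventually_elim simp
  have int: "integrable lborel (\<lambda>y. 2 * pi * whitham_kernel y)"
    using bound by (intro integrableI_nonneg pos2) (auto intro: le_less_trans)
  then show "integrable lborel whitham_kernel" by simp
  have "ennreal (LINT y|lborel. 2 * pi * whitham_kernel y) \<le> ennreal (2 * pi)"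
    using bound nn_integral_eq_integral[OF int pos2] by simp
  then have "(LINT y|lborel. 2 * pi * whitham_kernel y) \<le> 2 * pi" by (simp add: ennreal_le_iff)
  then show "(LINT y|lborel. whitham_kernel y) \<le> 1" by simp
qed

lemma whitham_kernel_reflected:
  shows "AE y in lebesgue. 0 < whitham_kernel (x - y)"
    and "integrable lebesgue (\<lambda>y. whitham_kernel (x - y))"
    and "(LINT y|lebesgue. whitham_kernel (x - y)) = (LINT y|lborel. whitham_kernel y)"
proof -
  have m: "(\<lambda>y. whitham_kernel (x - y)) \<in> borel_measurable lborel" by simp
  show "AE y in lebesgue. 0 < whitham_kernel (x - y)"
    using whitham_kernel_AE_pos by (rule AE_completion)
  show "integrable lebesgue (\<lambda>y. whitham_kernel (x - y))"
    unfolding integrable_completion[OF m]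
    using lborel_integrable_real_affine[OF whitham_kernel_integrable, of "-1" x] by simp
  show "(LINT y|lebesgue. whitham_kernel (x - y)) = (LINT y|lborel. whitham_kernel y)"
    unfolding integral_completion[OF m]
    using lborel_integral_real_affine[of "-1" whitham_kernel x] by simp
qed

section \<open>Touching solutions\<close>

theorem proposition4p6:
  fixes \<phi> \<phi>' :: "real \<Rightarrow> real" and \<mu> \<mu>' :: real
  assumes "steady_whitham_solution \<phi> \<mu>"
    and "steady_whitham_solution \<phi>' \<mu>'"
    and "\<mu> \<in> {1<..<2}" and "\<mu>' \<in> {1<..<2}"
    and "range \<phi> \<subseteq> {0<..\<mu>/2}" and "range \<phi>' \<subseteq> {0<..\<mu>/2}"
    and "\<mu> \<ge> \<mu>'"
  shows "((\<forall>x. \<phi>' x \<ge> \<phi> x) \<and> (\<exists>x. \<phi>' x = \<phi> x) \<longrightarrow> \<phi>' = \<phi>) \<and>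
         (sign_shifting (\<lambda>x. \<phi>' x - \<phi> x) \<longrightarrow>
           (\<forall>x\<^sub>0. (\<forall>x. \<phi>' x\<^sub>0 - \<phi> x\<^sub>0 \<le> \<phi>' x - \<phi> x) \<longrightarrow> \<mu> - \<phi>' x\<^sub>0 - \<phi> x\<^sub>0 < 1))"
proof -
  define w where "w x = \<phi>' x - \<phi> x" for x
  have range: "0 < \<phi> x" "\<phi> x \<le> \<mu> / 2" "0 < \<phi>' x" "\<phi>' x \<le> \<mu> / 2" for x
    using assms(5,6) by (auto simp: subset_iff)
  have int: "integrable lebesgue (\<lambda>y. whitham_kernel (x - y) * w y)" for x
    using assms(1,2) unfolding steady_whitham_solution_def w_def right_diff_distrib
    by (intro Bochner_Integration.integrable_diff) auto
  have "whitham_op w x = whitham_op \<phi>' x - whitham_op \<phi> x" for x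
    using assms(1,2) unfolding steady_whitham_solution_def w_def right_diff_distrib whitham_op_def
    by (intro Bochner_Integration.integral_diff) auto
  moreover have "whitham_op \<phi> x = \<mu> * \<phi> x - (\<phi> x)\<^sup>2" "whitham_op \<phi>' x = \<mu>' * \<phi>' x - (\<phi>' x)\<^sup>2" for x
    using assms(1,2) unfolding steady_whitham_solution_def by (auto simp: algebra_simps)
  ultimately have op: "whitham_op w x = (\<mu> - \<phi>' x - \<phi> x) * w x - (\<mu> - \<mu>') * \<phi>' x" for x
    by (simp add: w_def power2_eq_square algebra_simps)
  have op_le: "whitham_op w x \<le> (\<mu> - \<phi>' x - \<phi> x) * w x" for x
    unfolding op using assms(7) range(3)[of x] by (simp add: less_imp_le)
  define k where "k = (LINT y|lborel. whitham_kernel y)"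
  have k: "k \<le> 1" unfolding k_def by (rule whitham_kernel_integral_le_1)
  \<comment> \<open>Where a function above the constant \<open>c\<close> has a convolution no larger than that of \<open>c\<close>, positivity
    of the kernel forces it to equal \<open>c\<close> almost everywhere.\<close>
  have AE_const: "AE y in lebesgue. w y = c"
    if c: "\<And>y. c \<le> w y" and le: "whitham_op w x \<le> c * k" for c x
  proof -
    have i: "integrable lebesgue (\<lambda>y. whitham_kernel (x - y) * w y - c * whitham_kernel (x - y))"
      using int whitham_kernel_reflected(2) by simp
    have nn: "AE y in lebesgue. 0 \<le> whitham_kernel (x - y) * w y - c * whitham_kernel (x - y)"
      using whitham_kernel_reflected(1)[of x]
    proof eventually_elim
      case (elim y)
      then have "whitham_kernel (x - y) * c \<le> whitham_kernel (x - y) * w y" using c by (intro mult_left_mono) auto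
      then show ?case by (simp add: mult.commute)
    qed
    have "(LINT y|lebesgue. whitham_kernel (x - y) * w y - c * whitham_kernel (x - y)) =
        whitham_op w x - c * k"
      unfolding whitham_op_def k_def using int whitham_kernel_reflected(2,3) by simp
    with le integral_nonneg_AE[OF nn]
    have "(LINT y|lebesgue. whitham_kernel (x - y) * w y - c * whitham_kernel (x - y)) = 0" by linarith
    then have "AE y in lebesgue. whitham_kernel (x - y) * w y - c * whitham_kernel (x - y) = 0"
      using integral_nonneg_eq_0_iff_AE[OF i nn] by blast
    with whitham_kernel_reflected(1)[of x] show ?thesis
      by eventually_elim (auto simp: mult.commute)
  qed
  have op_const: "whitham_op w x = c * k"
    if "AE y in lebesgue. w y = c" for c x
  proof -
    have "whitham_op w x = (LINT y|lebesgue. c * whitham_kernel (x - y))"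
      unfolding whitham_op_def
    proof (rule integral_cong_AE)
      show "AE y in lebesgue. whitham_kernel (x - y) * w y = c * whitham_kernel (x - y)"
        using that by eventually_elim simp
    qed (use int[of x] whitham_kernel_reflected(2)[of x] in \<open>auto dest: borel_measurable_integrable\<close>)
    then show ?thesis by (simp add: whitham_kernel_reflected(3) k_def)
  qed
  \<comment> \<open>Equality almost everywhere becomes equality everywhere: the convolution of \<open>w\<close> vanishes at all
    points, and the equation determines \<open>w\<close> from it because neither solution exceeds \<open>\<mu> / 2\<close>.\<close>
  have "\<phi>' = \<phi>" if ge: "\<And>x. \<phi> x \<le> \<phi>' x" and x0: "\<phi>' x0 = \<phi> x0" for x0
  proof -
    have "AE y in lebesgue. w y = 0"
      by (rule AE_const[of 0 x0]) (use ge x0 op_le[of x0] in \<open>auto simp: w_def\<close>)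
    then have zero: "whitham_op w x = 0" for x using op_const[of 0] by simp
    with op[of x0] x0 range(3)[of x0] have "\<mu> = \<mu>'" by (simp add: w_def)
    show ?thesis
    proof
      fix x
      from op[of x] zero \<open>\<mu> = \<mu>'\<close> have "(\<mu> - \<phi>' x - \<phi> x) * w x = 0" by simp
      then show "\<phi>' x = \<phi> x" using range[of x] by (auto simp: w_def)
    qed
  qed
  moreover have "\<mu> - \<phi>' x0 - \<phi> x0 < 1"
    if shift: "sign_shifting (\<lambda>x. \<phi>' x - \<phi> x)" and min: "\<And>x. w x0 \<le> w x" for x0
  proof (rule ccontr)
    assume ge: "\<not> \<mu> - \<phi>' x0 - \<phi> x0 < 1"
    obtain p q where p: "w p > 0" and q: "w q < 0" using shift by (auto simp: sign_shifting_def w_def)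
    have neg: "w x0 < 0" using min[of q] q by linarith
    \<comment> \<open>If the factor at the minimum were at least 1, the convolution there could not exceed the negative
      minimum times the mass of the kernel, so \<open>w\<close> would equal its minimum almost everywhere.\<close>
    have 1: "(\<mu> - \<phi>' x0 - \<phi> x0) * w x0 \<le> 1 * w x0" using ge neg by (intro mult_right_mono_neg) auto
    have 2: "1 * w x0 \<le> k * w x0" using k neg by (intro mult_right_mono_neg) auto
    have "whitham_op w x0 \<le> w x0 * k"
      using op_le[of x0] 1 2 by (simp add: mult.commute)
    then have "AE y in lebesgue. w y = w x0" using min by (intro AE_const) auto
    then have const: "whitham_op w x = w x0 * k" for x by (rule op_const)
    \<comment> \<open>All inequalities between the convolution and the minimum are now equalities. This forces equal
      speeds and unit mass, and then the equation makes \<open>w\<close> negative at \<open>p\<close> too.\<close>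
    have "(\<mu> - \<mu>') * \<phi>' x0 \<le> 0" "1 * w x0 = k * w x0"
      using 1 2 op[of x0] op_le[of x0] const[of x0] by (simp_all add: mult.commute)
    then have "\<mu> = \<mu>'" "k = 1"
      using assms(7) range(3)[of x0] neg by (auto simp: mult_le_0_iff)
    then have "(\<mu> - \<phi>' p - \<phi> p) * w p < 0" using op[of p] const[of p] neg by simp
    moreover have "0 \<le> (\<mu> - \<phi>' p - \<phi> p) * w p" using range[of p] p by simp
    ultimately show False by linarith
  qed
  ultimately show ?thesis unfolding w_def by auto
qed

end
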